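(* Suppose that $\varphi$ is an analytic self-map of the unit disk $D$, $u\in H(D)$, $0<p<\infty$, and that $\phi$ is normal on $[0,1)$. Then the weighted composition operator $uC_\varphi : H(p,p,\phi)\to\mathcal{B}_0$ is compact if and only if $$\lim_{|z|\to1}\frac{(1-|z|^2)|u'(z)|}{\phi(|\varphi(z)|)(1-|\varphi(z)|^2)^{1/p}}=0\quad\text{and}\quad \lim_{|z|\to1}\frac{(1-|z|^2)|u(z)\varphi'(z)|}{\phi(|\varphi(z)|)(1-|\varphi(z)|^2)^{1+1/p}}=0.$$
   Context: $D$ is the open unit disk in $\mathbb{C}$ and $H(D)$ is the class of all analytic functions on $D$. An analytic self-map of $D$ is an analytic function $\varphi:D\to D$. For $u\in H(D)$, the weighted composition operator is $uC_\varphi f=u\cdot(f\circ\varphi)$, $f\in H(D)$. A positive continuous function $\phi$ on $[0,1)$ is called normal if there exist $s,t$ with $0<s<t$ such that $\frac{\phi(r)}{(1-r)^s}\downarrow 0$ and $\frac{\phi(r)}{(1-r)^t}\uparrow\infty$ as $r\to1^-$. For $0<p<\infty$ and normal $\phi$, $H(p,p,\phi)$ is the space of all $f\in H(D)$ such that $\|f\|_{H(p,p,\phi)}=\left(\int_0^1 M_p^p(f,r)\frac{\phi^p(r)}{1-r}\,r\,dr\right)^{1/p}<\infty$, where $M_p(f,r)=\left(\frac1{2\pi}\int_0^{2\pi}|f(re^{i\theta})|^p\,d\theta\right)^{1/p}$, $0\le r<1$ (a norm for $p\ge1$, a quasinorm for $0<p<1$). The Bloch space $\mathcal{B}$ is the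 space of $f\in H(D)$ with $B(f)=\sup_{z\in D}(1-|z|^2)|f'(z)|<\infty$, normed by $\|f\|_{\mathcal{B}}=|f(0)|+B(f)$. The little Bloch space $\mathcal{B}_0$ is the subspace of those $f\in\mathcal{B}$ with $(1-|z|^2)|f'(z)|\to0$ as $|z|\to1$, with the norm of $\mathcal{B}$. A linear operator is compact if it maps the first space into the second and takes bounded sets to sets with compact closure. *)

theory Defs
  imports "HOL-Analysis.Analysis"
begin

abbreviation unit_disk :: "complex set" ("\<D>") where
  "\<D> \<equiv> ball 0 1"

text \<open>Analytic functions on the disk are represented by total functions that are zero off the
  disk, so that equality in the space is equality of functions on the disk.\<close>

definition analytic_disk :: "(complex \<Rightarrow> complex) set" where
  "analytic_disk = {f. f holomorphic_on \<D> \<and> (\<forall>z. z \<notin> \<D> \<longrightarrow> f z = 0)}"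

text \<open>The arrows in the definition of normality are read as monotonicity near 1
  together with the stated limit.\<close>

definition normal_weight :: "(real \<Rightarrow> real) \<Rightarrow> bool" where
  "normal_weight \<phi> \<longleftrightarrow>
     continuous_on {0..<1} \<phi> \<and> (\<forall>r\<in>{0..<1}. 0 < \<phi> r) \<and>
     (\<exists>s t r0. 0 < s \<and> s < t \<and> r0 \<in> {0..<1} \<and>
        antimono_on {r0..<1} (\<lambda>r. \<phi> r / (1 - r) powr s) \<and>
        ((\<lambda>r. \<phi> r / (1 - r) powr s) \<longlongrightarrow> 0) (at_left 1) \<and>
        mono_on {r0..<1} (\<lambda>r. \<phi> r / (1 - r) powr t) \<and>
        filterlim (\<lambda>r. \<phi> r / (1 - r) powr t) at_top (at_left 1))"

definition integral_mean :: "real \<Rightarrow> (complex \<Rightarrow> complex) \<Rightarrow> real \<Rightarrow> real" where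
  "integral_mean p f r =
     (1 / (2 * pi) * (LINT \<theta>:{0..2*pi}|lborel. norm (f (of_real r * cis \<theta>)) powr p)) powr (1 / p)"

definition mixed_integral :: "real \<Rightarrow> (real \<Rightarrow> real) \<Rightarrow> (complex \<Rightarrow> complex) \<Rightarrow> ennreal" where
  "mixed_integral p \<phi> f =
     (\<integral>\<^sup>+r\<in>{0..<1}. ennreal (integral_mean p f r powr p * (\<phi> r powr p / (1 - r)) * r) \<partial>lborel)"

definition mixed_space :: "real \<Rightarrow> (real \<Rightarrow> real) \<Rightarrow> (complex \<Rightarrow> complex) set" where
  "mixed_space p \<phi> = {f \<in> analytic_disk. mixed_integral p \<phi> f < \<infinity>}"

definition mixed_norm :: "real \<Rightarrow> (real \<Rightarrow> real) \<Rightarrow> (complex \<Rightarrow> complex) \<Rightarrow> real" where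
  "mixed_norm p \<phi> f = enn2real (mixed_integral p \<phi> f) powr (1 / p)"

definition bloch_seminorm :: "(complex \<Rightarrow> complex) \<Rightarrow> ennreal" where
  "bloch_seminorm f = (SUP z\<in>\<D>. ennreal ((1 - (norm z)\<^sup>2) * norm (deriv f z)))"

definition bloch_space :: "(complex \<Rightarrow> complex) set" where
  "bloch_space = {f \<in> analytic_disk. bloch_seminorm f < \<infinity>}"

definition bloch_norm :: "(complex \<Rightarrow> complex) \<Rightarrow> real" where
  "bloch_norm f = norm (f 0) + enn2real (bloch_seminorm f)"

text \<open>The filter of \<open>|z| \<rightarrow> 1\<close> with \<open>z\<close> in the disk.\<close>

definition to_circle :: "complex filter" where
  "to_circle = filtercomap norm (at_left 1)"

definition little_bloch_space :: "(complex \<Rightarrow> complex) set" where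
  "little_bloch_space =
     {f \<in> bloch_space. ((\<lambda>z. (1 - (norm z)\<^sup>2) * norm (deriv f z)) \<longlongrightarrow> 0) to_circle}"

definition weighted_composition ::
  "(complex \<Rightarrow> complex) \<Rightarrow> (complex \<Rightarrow> complex) \<Rightarrow> (complex \<Rightarrow> complex) \<Rightarrow> complex \<Rightarrow> complex" where
  "weighted_composition u \<psi> f = (\<lambda>z. if z \<in> \<D> then u z * f (\<psi> z) else 0)"

definition norm_dist ::
  "((complex \<Rightarrow> complex) \<Rightarrow> real) \<Rightarrow> (complex \<Rightarrow> complex) \<Rightarrow> (complex \<Rightarrow> complex) \<Rightarrow> real" where
  "norm_dist N f g = N (\<lambda>z. f z - g z)"

text \<open>Compactness of a linear operator from \<open>X\<close> to \<open>Y\<close>, (quasi)normed by \<open>NX\<close> and \<open>NY\<close>;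
  the closure is taken in the metric topology of \<open>Y\<close>.\<close>

definition compact_operator ::
  "(complex \<Rightarrow> complex) set \<Rightarrow> ((complex \<Rightarrow> complex) \<Rightarrow> real) \<Rightarrow>
   (complex \<Rightarrow> complex) set \<Rightarrow> ((complex \<Rightarrow> complex) \<Rightarrow> real) \<Rightarrow>
   ((complex \<Rightarrow> complex) \<Rightarrow> (complex \<Rightarrow> complex)) \<Rightarrow> bool" where
  "compact_operator X NX Y NY T \<longleftrightarrow>
     (\<forall>f\<in>X. \<forall>g\<in>X. \<forall>a b. T (\<lambda>z. a * f z + b * g z) = (\<lambda>z. a * T f z + b * T g z)) \<and>
     T ` X \<subseteq> Y \<and>
     (\<forall>S\<subseteq>X. (\<exists>C. \<forall>f\<in>S. NX f \<le> C) \<longrightarrow>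
        (let \<tau> = Metric_space.mtopology Y (norm_dist NY) in compactin \<tau> (\<tau> closure_of (T ` S))))"

text \<open>The Bloch norm does induce a metric, so the topology used above is meaningful.\<close>

lemma deriv_diff_disk:
  assumes "f \<in> analytic_disk" "g \<in> analytic_disk" "z \<in> \<D>"
  shows "deriv (\<lambda>z. f z - g z) z = deriv f z - deriv g z"
proof -
  have "f field_differentiable at z" "g field_differentiable at z"
    using assms holomorphic_on_imp_differentiable_at[of _ "\<D>" z]
    by (auto simp: analytic_disk_def)
  then show ?thesis by simp
qed

lemma norm_deriv_minus_commute:
  "norm (deriv (\<lambda>z. f z - g z) z) = norm (deriv (\<lambda>z. g z - f z) (z :: complex) :: complex)"
proof (cases "(\<lambda>z. f z - g z) field_differentiable at z")
  case True
  have "deriv (\<lambda>z. g z - f z) z = deriv (\<lambda>z. - (f z - g z)) z"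
    by simp
  also have "\<dots> = - deriv (\<lambda>z. f z - g z) z"
    using True by (rule deriv_minus)
  finally show ?thesis by simp
next
  case False
  have F: "\<not> (\<lambda>z. g z - f z) field_differentiable at z"
  proof
    assume "(\<lambda>z. g z - f z) field_differentiable at z"
    then have "(\<lambda>z. - (g z - f z)) field_differentiable at z"
      by (rule field_differentiable_minus)
    with False show False by simp
  qed
  have "(\<lambda>D. DERIV (\<lambda>z. f z - g z) z :> D) = (\<lambda>D. DERIV (\<lambda>z. g z - f z) z :> D)"
    using False F unfolding field_differentiable_def by auto
  then show ?thesis unfolding deriv_def by simp
qed

lemma bloch_seminorm_triangle:
  assumes "f \<in> analytic_disk" "g \<in> analytic_disk" "h \<in> analytic_disk"
  shows "bloch_seminorm (\<lambda>z. f z - h z) \<le>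
         bloch_seminorm (\<lambda>z. f z - g z) + bloch_seminorm (\<lambda>z. g z - h z)"
  unfolding bloch_seminorm_def
proof (rule SUP_least)
  fix z :: complex assume z: "z \<in> \<D>"
  define w where "w = 1 - (norm z)\<^sup>2"
  have w: "0 \<le> w" using z by (simp add: w_def power_le_one)
  have "norm (deriv (\<lambda>z. f z - h z) z) \<le>
        norm (deriv (\<lambda>z. f z - g z) z) + norm (deriv (\<lambda>z. g z - h z) z)"
    using norm_triangle_ineq[of "deriv f z - deriv g z" "deriv g z - deriv h z"]
    unfolding deriv_diff_disk[OF assms(1,3) z] deriv_diff_disk[OF assms(1,2) z]
      deriv_diff_disk[OF assms(2,3) z]
    by simp
  then have "w * norm (deriv (\<lambda>z. f z - h z) z) \<le>
        w * norm (deriv (\<lambda>z. f z - g z) z) + w * norm (deriv (\<lambda>z. g z - h z) z)"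
    using w by (metis distrib_left mult_left_mono)
  then have "ennreal (w * norm (deriv (\<lambda>z. f z - h z) z)) \<le>
        ennreal (w * norm (deriv (\<lambda>z. f z - g z) z)) +
        ennreal (w * norm (deriv (\<lambda>z. g z - h z) z))"
    using w by (simp flip: ennreal_plus add: ennreal_leI)
  also have "\<dots> \<le> (SUP z\<in>\<D>. ennreal ((1 - (norm z)\<^sup>2) * norm (deriv (\<lambda>z. f z - g z) z))) +
       (SUP z\<in>\<D>. ennreal ((1 - (norm z)\<^sup>2) * norm (deriv (\<lambda>z. g z - h z) z)))"
    unfolding w_def by (intro add_mono SUP_upper z)
  finally show "ennreal ((1 - (norm z)\<^sup>2) * norm (deriv (\<lambda>z. f z - h z) z)) \<le> \<dots>"
    unfolding w_def .
qed

lemma bloch_seminorm_diff_finite: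
  assumes "f \<in> bloch_space" "g \<in> bloch_space"
  shows "bloch_seminorm (\<lambda>z. f z - g z) < \<infinity>"
proof -
  have 0: "(\<lambda>z. 0) \<in> analytic_disk" by (simp add: analytic_disk_def)
  have eq: "bloch_seminorm (\<lambda>z. 0 - g z) = bloch_seminorm (\<lambda>z. g z - 0)"
    unfolding bloch_seminorm_def norm_deriv_minus_commute[of "\<lambda>z. 0"] ..
  have "bloch_seminorm (\<lambda>z. f z - g z) \<le>
      bloch_seminorm (\<lambda>z. f z - 0) + bloch_seminorm (\<lambda>z. 0 - g z)"
    using assms 0 by (intro bloch_seminorm_triangle) (auto simp: bloch_space_def)
  also have "\<dots> < \<infinity>"
    unfolding eq using assms by (simp add: bloch_space_def)
  finally show ?thesis .
qed

lemma Metric_space_bloch: "Metric_space bloch_space (norm_dist bloch_norm)"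
proof
  fix f g :: "complex \<Rightarrow> complex"
  show "0 \<le> norm_dist bloch_norm f g"
    by (simp add: norm_dist_def bloch_norm_def)
  show "norm_dist bloch_norm f g = norm_dist bloch_norm g f"
    unfolding norm_dist_def bloch_norm_def bloch_seminorm_def norm_deriv_minus_commute[of f]
    by (simp add: norm_minus_commute)
next
  fix f g assume f: "f \<in> bloch_space" and g: "g \<in> bloch_space"
  show "norm_dist bloch_norm f g = 0 \<longleftrightarrow> f = g"
  proof
    assume "norm_dist bloch_norm f g = 0"
    then have z0: "f 0 = g 0" and e: "enn2real (bloch_seminorm (\<lambda>z. f z - g z)) = 0"
      unfolding norm_dist_def bloch_norm_def by (auto simp: add_nonneg_eq_0_iff)
    have s: "bloch_seminorm (\<lambda>z. f z - g z) = 0"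
      using e bloch_seminorm_diff_finite[OF f g] by (auto simp: enn2real_eq_0_iff)
    have hol: "(\<lambda>z. f z - g z) holomorphic_on \<D>"
      using f g by (auto simp: bloch_space_def analytic_disk_def intro: holomorphic_on_diff)
    have d0: "((\<lambda>z. f z - g z) has_field_derivative 0) (at z within \<D>)" if z: "z \<in> \<D>" for z
    proof -
      have "ennreal ((1 - (norm z)\<^sup>2) * norm (deriv (\<lambda>z. f z - g z) z)) \<le> 0"
        unfolding s[symmetric] bloch_seminorm_def using z by (intro SUP_upper)
      moreover have "0 < 1 - (norm z)\<^sup>2"
        using z by (simp add: abs_square_less_1)
      ultimately have "deriv (\<lambda>z. f z - g z) z = 0"
        by (auto simp: ennreal_eq_0_iff mult_le_0_iff)
      then show ?thesis
        using holomorphic_derivI[OF hol open_ball z]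
        by (metis has_field_derivative_at_within)
    qed
    obtain c where c: "\<And>z. z \<in> \<D> \<Longrightarrow> f z - g z = c"
      using has_field_derivative_zero_constant[OF convex_ball d0] by blast
    have "c = 0" using c[of 0] z0 by simp
    show "f = g"
    proof
      fix z show "f z = g z"
        using c[of z] \<open>c = 0\<close> f g
        by (cases "z \<in> \<D>") (auto simp: bloch_space_def analytic_disk_def)
    qed
  next
    assume "f = g"
    then show "norm_dist bloch_norm f g = 0"
      by (simp add: norm_dist_def bloch_norm_def bloch_seminorm_def)
  qed
next
  fix f g h assume f: "f \<in> bloch_space" and g: "g \<in> bloch_space" and h: "h \<in> bloch_space"
  have "enn2real (bloch_seminorm (\<lambda>z. f z - h z)) \<le>
      enn2real (bloch_seminorm (\<lambda>z. f z - g z) + bloch_seminorm (\<lambda>z. g z - h z))"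
    using f g h bloch_seminorm_diff_finite[OF f g] bloch_seminorm_diff_finite[OF g h]
    by (intro enn2real_mono bloch_seminorm_triangle) (auto simp: bloch_space_def)
  also have "\<dots> = enn2real (bloch_seminorm (\<lambda>z. f z - g z)) +
      enn2real (bloch_seminorm (\<lambda>z. g z - h z))"
    using bloch_seminorm_diff_finite[OF f g] bloch_seminorm_diff_finite[OF g h]
    by (intro enn2real_plus) auto
  finally show "norm_dist bloch_norm f h \<le> norm_dist bloch_norm f g + norm_dist bloch_norm g h"
    using norm_triangle_ineq[of "f 0 - g 0" "g 0 - h 0"]
    by (simp add: norm_dist_def bloch_norm_def)
qed

lemma Metric_space_little_bloch: "Metric_space little_bloch_space (norm_dist bloch_norm)"
  by (rule Metric_space.subspace[OF Metric_space_bloch]) (auto simp: little_bloch_space_def)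

end

theory Submission
  imports Defs "HOL-Complex_Analysis.Complex_Analysis"
begin

text \<open>Write \<open>\<omega>(r) = 1 / (\<phi>(r) (1 - r\<^sup>2)\<^bsup>1/p\<^esup>)\<close> (\<open>growth\<close> below). The theorem rests on the fact that
\<open>\<omega>(|a|)\<close> and \<open>\<omega>(|a|) / (1 - |a|\<^sup>2)\<close> are, up to constants, the largest values at \<open>a\<close> of \<open>|f|\<close> and
of \<open>|f'|\<close> for \<open>f\<close> in the unit ball of \<open>H(p,p,\<phi>)\<close>. As
\<open>(u \<cdot> f \<circ> \<psi>)' = u' \<cdot> f \<circ> \<psi> + u \<psi>' \<cdot> f' \<circ> \<psi>\<close>, the two quotients of the theorem are, up to
constants, the largest contributions of these two terms to \<open>(1 - |z|\<^sup>2) |(u \<cdot> f \<circ> \<psi>)'(z)|\<close>.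

Upper bounds (\<open>mixed_norm_bounded_imp_growth_class\<close>, \<open>growth_class_deriv_bound\<close>). The value of
\<open>|f|\<^sup>p\<close> at a point is controlled by the means of \<open>|f|\<^sup>p\<close> over circles slightly further out, on
which a normal weight is at least a constant multiple of its value at the point. For \<open>p \<le> 1\<close> this
comes from the Cauchy formula by choosing a point that maximises \<open>|f|\<close> against a power of the
distance to an outer circle; for larger \<open>p\<close> the same is applied to a power of \<open>f\<close>.

Lower bounds (\<open>mixed_integral_upper_bound\<close>, \<open>test_functions_bounded\<close>). Multiples by \<open>\<omega>(|a|)\<close> of
a high power of \<open>(1 - |a|\<^sup>2) / (1 - cnj a z)\<close>, corrected by a Moebius factor, are bounded in
\<open>H(p,p,\<phi>)\<close> uniformly in \<open>a\<close>, and attain the extremal value with slope zero at \<open>a\<close>, or the extremal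
slope with value zero at \<open>a\<close>.

If both quotients vanish at the circle, compactness follows from the upper bounds: they place a ball
of \<open>H(p,p,\<phi>)\<close> inside the class of functions dominated by a multiple of \<open>\<omega>\<close>. This class is a normal
family that is closed under locally uniform limits, and the operator turns locally uniform
convergence inside it into convergence in \<open>\<B>\<^sub>0\<close>. So the image of a bounded set lies in a compact set
(\<open>compactin_T_growth_class\<close>).

Conversely, a relatively compact subset of \<open>\<B>\<^sub>0\<close> has finite nets, so that
\<open>(1 - |z|\<^sup>2) |h'(z)|\<close> tends to \<open>0\<close> at the circle uniformly for \<open>h\<close> in the set
(\<open>compact_closure_imp_uniform_little_bloch\<close>). Evaluating this at \<open>z\<close> on the images of the two test
functions with \<open>a = \<psi>(z)\<close> isolates the two quotients.\<close>

section \<open>Sub-mean estimates on circles\<close>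

definition circle_mean :: "real \<Rightarrow> (complex \<Rightarrow> complex) \<Rightarrow> real \<Rightarrow> real" where
  "circle_mean q f r =
     1 / (2 * pi) * (LINT \<theta>:{0..2*pi}|lborel. norm (f (of_real r * cis \<theta>)) powr q)"

lemma circle_mean_nonneg: "0 \<le> circle_mean q f r"
  unfolding circle_mean_def set_lebesgue_integral_def
  by (intro mult_nonneg_nonneg Bochner_Integration.integral_nonneg) auto

lemma integral_mean_powr:
  assumes "0 < p"
  shows "integral_mean p f r powr p = circle_mean p f r"
proof -
  have "integral_mean p f r = circle_mean p f r powr (1 / p)"
    unfolding integral_mean_def circle_mean_def ..
  then show ?thesis using assms circle_mean_nonneg[of p f r] by (simp add: powr_powr)
qed

text \<open>Passing from \<open>f\<close> to a power of \<open>f\<close> trades the exponent \<open>p\<close> for a smaller one, which reduces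
pointwise estimates to exponents at most \<open>1\<close>.\<close>

lemma circle_mean_power:
  assumes "0 < n"
  shows "circle_mean (p / real n) (\<lambda>z. f z ^ n) r = circle_mean p f r"
proof -
  have "(x ^ n) powr (p / real n) = x powr p" if "0 \<le> x" for x :: real
  proof -
    have "(x ^ n) powr (p / real n) = (x powr real n) powr (p / real n)"
      using that assms by (simp add: powr_realpow')
    also have "\<dots> = x powr p" using assms by (simp add: powr_powr)
    finally show ?thesis .
  qed
  then show ?thesis unfolding circle_mean_def by (simp add: norm_power)
qed

lemma continuous_on_circle:
  assumes "g holomorphic_on \<D>" "0 \<le> \<rho>" "\<rho> < 1"
  shows "continuous_on A (\<lambda>t. g (of_real \<rho> * cis t))"
proof (rule continuous_on_compose2[of \<D> g])
  show "continuous_on \<D> g" using assms(1) by (rule holomorphic_on_imp_continuous_on)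
  show "continuous_on A (\<lambda>t. of_real \<rho> * cis t)" by (intro continuous_intros)
  show "(\<lambda>t. of_real \<rho> * cis t) ` A \<subseteq> \<D>" using assms by (auto simp: norm_mult)
qed

lemma circle_mean_eq_integral:
  assumes "g holomorphic_on \<D>" "0 \<le> \<rho>" "\<rho> < 1" "0 < q"
  shows "(\<lambda>t. norm (g (of_real \<rho> * cis t)) powr q) integrable_on {0..2*pi}"
    and "circle_mean q g \<rho> =
           1 / (2 * pi) * integral {0..2*pi} (\<lambda>t. norm (g (of_real \<rho> * cis t)) powr q)"
proof -
  have c: "continuous_on {0..2*pi} (\<lambda>t. norm (g (of_real \<rho> * cis t)) powr q)"
    using assms(4) by (intro continuous_on_powr' continuous_intros continuous_on_circle assms) auto
  then show "(\<lambda>t. norm (g (of_real \<rho> * cis t)) powr q) integrable_on {0..2*pi}"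
    by (rule integrable_continuous_interval)
  have "set_integrable lborel {0..2*pi} (\<lambda>t. norm (g (of_real \<rho> * cis t)) powr q)"
    by (rule borel_integrable_atLeastAtMost'[OF c])
  then show "circle_mean q g \<rho> =
           1 / (2 * pi) * integral {0..2*pi} (\<lambda>t. norm (g (of_real \<rho> * cis t)) powr q)"
    unfolding circle_mean_def by (simp add: set_borel_integral_eq_integral)
qed

lemma circle_mean_mono:
  assumes "f holomorphic_on \<D>" "g holomorphic_on \<D>" "0 \<le> \<rho>" "\<rho> < 1" "0 < q" "0 < q'"
    and le: "\<And>w. norm w = \<rho> \<Longrightarrow> norm (f w) powr q \<le> K * norm (g w) powr q'"
  shows "circle_mean q f \<rho> \<le> K * circle_mean q' g \<rho>"
proof -
  have "integral {0..2*pi} (\<lambda>t. norm (f (of_real \<rho> * cis t)) powr q)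
      \<le> integral {0..2*pi} (\<lambda>t. K * norm (g (of_real \<rho> * cis t)) powr q')"
    using assms by (intro integral_le circle_mean_eq_integral integrable_on_mult_right le)
      (auto simp: norm_mult)
  then show ?thesis
    using assms by (simp add: circle_mean_eq_integral divide_right_mono)
qed

lemma Cauchy_circle_integral:
  assumes "g holomorphic_on \<D>" "norm w < \<rho>" "\<rho> < 1"
  shows "((\<lambda>t. g (of_real \<rho> * cis t) / (of_real \<rho> * cis t - w) * (of_real \<rho> * cis t))
           has_integral (2 * of_real pi * g w)) {0..2*pi}"
proof -
  have "((\<lambda>u. g u / (u - w)) has_contour_integral (2 * of_real pi * \<i> * g w)) (circlepath 0 \<rho>)"
    using assms by (intro Cauchy_integral_circlepath_simple holomorphic_on_subset[OF assms(1)]) auto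
  then have "((\<lambda>t. g (of_real \<rho> * cis t) / (of_real \<rho> * cis t - w) * of_real \<rho> * \<i> * cis t)
       has_integral (2 * of_real pi * \<i> * g w)) {0..2*pi}"
    unfolding circlepath_def by (subst (asm) has_contour_integral_part_circlepath_iff) auto
  from has_integral_mult_right[OF this, of "-\<i>"] show ?thesis
    by (simp add: algebra_simps)
qed

lemma norm_le_circle_mean_1:
  assumes "g holomorphic_on \<D>" "norm w < \<rho>" "\<rho> < 1"
  shows "norm (g w) \<le> \<rho> / (\<rho> - norm w) * circle_mean 1 g \<rho>"
proof -
  have \<rho>: "0 \<le> \<rho>" using assms(2) norm_ge_zero[of w] by linarith
  define h where "h = (\<lambda>t. g (of_real \<rho> * cis t) / (of_real \<rho> * cis t - w) * (of_real \<rho> * cis t))"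
  have h: "(h has_integral (2 * of_real pi * g w)) {0..2*pi}"
    unfolding h_def by (rule Cauchy_circle_integral[OF assms])
  have "norm (integral {0..2*pi} h) \<le>
      integral {0..2*pi} (\<lambda>t. \<rho> / (\<rho> - norm w) * norm (g (of_real \<rho> * cis t)) powr 1)"
  proof (rule integral_norm_bound_integral)
    show "h integrable_on {0..2*pi}" using h by blast
    show "(\<lambda>t. \<rho> / (\<rho> - norm w) * norm (g (of_real \<rho> * cis t)) powr 1) integrable_on {0..2*pi}"
      using assms \<rho> by (intro integrable_on_mult_right circle_mean_eq_integral) auto
    fix t
    have "\<rho> - norm w \<le> norm (of_real \<rho> * cis t - w)"
      using norm_triangle_ineq2[of "of_real \<rho> * cis t" w] \<rho> by (simp add: norm_mult)
    then have "norm (g (of_real \<rho> * cis t)) * \<rho> / norm (of_real \<rho> * cis t - w) \<le>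
        norm (g (of_real \<rho> * cis t)) * \<rho> / (\<rho> - norm w)"
      using assms \<rho> by (intro divide_left_mono mult_nonneg_nonneg mult_pos_pos) auto
    then show "norm (h t) \<le> \<rho> / (\<rho> - norm w) * norm (g (of_real \<rho> * cis t)) powr 1"
      using \<rho> by (simp add: h_def norm_mult norm_divide mult.commute)
  qed
  then have "2 * pi * norm (g w) \<le> \<rho> / (\<rho> - norm w) *
      integral {0..2*pi} (\<lambda>t. norm (g (of_real \<rho> * cis t)) powr 1)"
    using integral_unique[OF h] by (simp add: norm_mult)
  moreover have "integral {0..2*pi} (\<lambda>t. norm (g (of_real \<rho> * cis t)) powr 1)
      = 2 * pi * circle_mean 1 g \<rho>"
    using circle_mean_eq_integral(2)[OF assms(1) \<rho> assms(3), of 1] by simp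
  ultimately have "2 * pi * norm (g w) \<le> 2 * pi * (\<rho> / (\<rho> - norm w) * circle_mean 1 g \<rho>)"
    by (simp add: mult.left_commute)
  then show ?thesis by (rule mult_left_le_imp_le) simp
qed

text \<open>A substitute for the subharmonicity of \<open>|g|\<^sup>q\<close>. Let \<open>w0\<close> maximise \<open>(R - |w|)\<^bsup>2/q\<^esup> |g(w)|\<close> on
the annulus \<open>|z| \<le> |w| \<le> R\<close> and let \<open>d\<close> be a quarter of the distance from \<open>w0\<close> to the outer
circle. On the circles of radii between \<open>|w0| + d\<close> and \<open>|w0| + 2 d\<close>, \<open>|g|\<close> is at most a
constant times \<open>|g(w0)|\<close>, so that \<open>|g| \<le> C |g(w0)|\<^bsup>1-q\<^esup> |g|\<^sup>q\<close> there; the Cauchy formula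
then bounds \<open>|g(w0)|\<^sup>q\<close> by a constant times the mean of \<open>|g|\<^sup>q\<close> divided by \<open>d\<close>, and
maximality carries this back to \<open>z\<close>. The radii fill an interval of length \<open>d\<close>, which absorbs
that factor when the estimate is integrated, and they stay above \<open>|z|\<close>, where the weight is
under control.\<close>

lemma norm_powr_le_circle_mean_annulus_le_1:
  assumes g: "g holomorphic_on \<D>" and q: "0 < q" "q \<le> 1" and zR: "norm z < R" and R: "R < 1"
  shows "\<exists>\<alpha> d. norm z \<le> \<alpha> \<and> 0 < d \<and> \<alpha> + d \<le> R \<and> (\<forall>\<rho>\<in>{\<alpha>..\<alpha>+d}.
           (R - norm z)\<^sup>2 * norm (g z) powr q \<le> 16 * 4 powr (1 / q) * d * circle_mean q g \<rho>)"
proof (cases "g z = 0")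
  case True
  then show ?thesis
    using zR q circle_mean_nonneg[of q g]
    by (intro exI[of _ "norm z"] exI[of _ "R - norm z"]) auto
next
  case False
  define A where "A = cball (0::complex) R - ball 0 (norm z)"
  define H where "H = (\<lambda>w. (R - norm w) powr (2 / q) * norm (g w))"
  have AD: "A \<subseteq> \<D>" using R by (auto simp: A_def)
  have "compact A" unfolding A_def by (intro compact_diff) auto
  moreover have "z \<in> A" using zR by (simp add: A_def)
  moreover have "continuous_on A H"
    unfolding H_def using q AD
    by (intro continuous_intros continuous_on_powr'
        holomorphic_on_imp_continuous_on[OF holomorphic_on_subset[OF g]]) (auto simp: A_def)
  ultimately obtain w0 where w0: "w0 \<in> A" and max: "\<And>w. w \<in> A \<Longrightarrow> H w \<le> H w0"
    using continuous_attains_sup[of A H] by blast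
  have "0 < H z" using False zR by (simp add: H_def)
  with max[OF \<open>z \<in> A\<close>] have H0: "0 < H w0" by linarith
  then have "norm w0 \<noteq> R" and g0: "g w0 \<noteq> 0" using q by (auto simp: H_def)
  with w0 have w0R: "norm z \<le> norm w0" "norm w0 < R" by (auto simp: A_def)
  define d where "d = (R - norm w0) / 4"
  have d: "0 < d" "R - norm w0 = 4 * d" using w0R by (auto simp: d_def)
  have key: "(R - norm z)\<^sup>2 * norm (g z) powr q \<le> 16 * 4 powr (1 / q) * d * circle_mean q g \<rho>"
    if \<rho>: "\<rho> \<in> {norm w0 + d..norm w0 + d + d}" for \<rho>
  proof -
    have \<rho>': "norm w0 < \<rho>" "\<rho> < 1" "0 \<le> \<rho>"
      using \<rho> d R order_trans[OF norm_ge_zero[of w0], of \<rho>] by auto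
    \<comment> \<open>On this circle the distance to the outer circle is at least half of that of \<open>w0\<close>, so
      maximality bounds \<open>g\<close> by a multiple of its value at \<open>w0\<close>.\<close>
    have sup: "norm (g w) \<le> 4 powr (1 / q) * norm (g w0)" if w: "norm w = \<rho>" for w
    proof -
      have "w \<in> A" using w \<rho> d w0R by (auto simp: A_def)
      have "(2 * d) powr (2 / q) * norm (g w) \<le> H w"
        unfolding H_def using w \<rho> d q by (intro mult_right_mono powr_mono2) auto
      also have "\<dots> \<le> (4 * d) powr (2 / q) * norm (g w0)"
        using max[OF \<open>w \<in> A\<close>] d by (simp add: H_def)
      also have "(4 * d) powr (2 / q) = (2 * d) powr (2 / q) * 2 powr (2 / q)"
        using d by (simp flip: powr_mult)
      also have "2 powr (2 / q) = (4::real) powr (1 / q)"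
        using powr_powr[of 2 2 "1/q"] by simp
      finally have "(2 * d) powr (2 / q) * norm (g w) \<le>
          (2 * d) powr (2 / q) * (4 powr (1 / q) * norm (g w0))"
        by (simp add: mult_ac)
      then show ?thesis using d by (simp add: mult_le_cancel_left_pos)
    qed
    define B where "B = 4 powr (1 / q) * norm (g w0)"
    have B: "0 < B" using g0 by (simp add: B_def)
    have "circle_mean 1 g \<rho> \<le> B powr (1 - q) * circle_mean q g \<rho>"
    proof (rule circle_mean_mono[OF g g])
      fix w :: complex assume "norm w = \<rho>"
      then have le: "norm (g w) \<le> B" using sup by (simp add: B_def)
      have "norm (g w) powr 1 = norm (g w) powr (1 - q) * norm (g w) powr q"
        using q by (simp flip: powr_add)
      also have "\<dots> \<le> B powr (1 - q) * norm (g w) powr q"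
        using le q by (intro mult_right_mono powr_mono2) auto
      finally show "norm (g w) powr 1 \<le> B powr (1 - q) * norm (g w) powr q" .
    qed (use \<rho>' q in auto)
    moreover have "\<rho> / (\<rho> - norm w0) \<le> 1 / d"
      using \<rho> \<rho>' d by (intro frac_le) auto
    ultimately have "\<rho> / (\<rho> - norm w0) * circle_mean 1 g \<rho> \<le>
        1 / d * (B powr (1 - q) * circle_mean q g \<rho>)"
      using d \<rho>' by (intro mult_mono) (auto intro: circle_mean_nonneg)
    then have "norm (g w0) \<le> 1 / d * (B powr (1 - q) * circle_mean q g \<rho>)"
      using norm_le_circle_mean_1[OF g \<rho>'(1,2)] by linarith
    then have "4 powr (1 / q) * norm (g w0) \<le>
        4 powr (1 / q) * (1 / d * (B powr (1 - q) * circle_mean q g \<rho>))"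
      by (intro mult_left_mono) auto
    then have "B \<le> B powr (1 - q) * (4 powr (1 / q) * circle_mean q g \<rho> / d)"
      by (simp add: B_def mult_ac)
    moreover have "B = B powr (1 - q) * B powr q" using B by (simp flip: powr_add)
    ultimately have Bq: "B powr q \<le> 4 powr (1 / q) * circle_mean q g \<rho> / d"
      using B by (metis mult_le_cancel_left_pos powr_gt_zero less_numeral_extra(3))
    have "norm (g w0) powr q \<le> B powr q"
    proof (rule powr_mono2)
      have "1 \<le> (4::real) powr (1 / q)" using q by (intro ge_one_powr_ge_zero) auto
      then show "norm (g w0) \<le> B" unfolding B_def using mult_right_mono by fastforce
    qed (use q in auto)
    with Bq have b: "norm (g w0) powr q \<le> 4 powr (1 / q) * circle_mean q g \<rho> / d" by linarith
    have Hq: "H w powr q = (R - norm w)\<^sup>2 * norm (g w) powr q" if "norm w \<le> R" for w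
      using that q by (simp add: H_def powr_mult powr_powr)
    have "(R - norm z)\<^sup>2 * norm (g z) powr q \<le> (R - norm w0)\<^sup>2 * norm (g w0) powr q"
      using powr_mono2[OF _ _ max[OF \<open>z \<in> A\<close>], of q] q zR w0R Hq[of z] Hq[of w0]
      by (simp add: H_def)
    also have "\<dots> \<le> (4 * d)\<^sup>2 * (4 powr (1 / q) * circle_mean q g \<rho> / d)"
      unfolding d(2) by (intro mult_left_mono b) auto
    also have "\<dots> = 16 * 4 powr (1 / q) * d * circle_mean q g \<rho>"
      using d by (simp add: power2_eq_square)
    finally show ?thesis .
  qed
  show ?thesis
    using key w0R d by (intro exI[of _ "norm w0 + d"] exI[of _ d]) auto
qed

text \<open>For \<open>p > 1\<close> the previous estimate is applied to \<open>f\<^sup>n\<close> with the exponent \<open>p / n \<le> 1\<close>.\<close>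

lemma norm_powr_le_circle_mean_annulus:
  assumes p: "0 < p"
  obtains C where "0 < C" and "\<And>f z R. f holomorphic_on \<D> \<Longrightarrow> norm z < R \<Longrightarrow> R < 1 \<Longrightarrow>
     \<exists>\<alpha> d. norm z \<le> \<alpha> \<and> 0 < d \<and> \<alpha> + d \<le> R \<and> (\<forall>\<rho>\<in>{\<alpha>..\<alpha>+d}.
        (R - norm z)\<^sup>2 * norm (f z) powr p \<le> C * d * circle_mean p f \<rho>)"
proof -
  define n where "n = nat \<lceil>p\<rceil>"
  have n: "0 < n" "p \<le> real n" using p by (auto simp: n_def)
  have q: "0 < p / real n" "p / real n \<le> 1" using n p by auto
  show thesis
  proof (rule that[of "16 * 4 powr (1 / (p / real n))"])
    fix f :: "complex \<Rightarrow> complex" and z :: complex and R :: real assume "f holomorphic_on \<D>" "norm z < R" "R < (1::real)"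
    moreover from this have "(\<lambda>z. f z ^ n) holomorphic_on \<D>" by (intro holomorphic_intros)
    moreover have "norm (f z ^ n) powr (p / real n) = norm (f z) powr p"
      using n by (cases "f z = 0") (auto simp: norm_power powr_powr simp flip: powr_realpow)
    ultimately show "\<exists>\<alpha> d. norm z \<le> \<alpha> \<and> 0 < d \<and> \<alpha> + d \<le> R \<and> (\<forall>\<rho>\<in>{\<alpha>..\<alpha>+d}.
        (R - norm z)\<^sup>2 * norm (f z) powr p \<le>
          16 * 4 powr (1 / (p / real n)) * d * circle_mean p f \<rho>)"
      using norm_powr_le_circle_mean_annulus_le_1[of "\<lambda>z. f z ^ n" "p / real n" z R] q
      by (simp add: circle_mean_power[OF n(1)] del: of_real_eq_id)
  qed simp
qed

section \<open>Global almost monotonicity of normal weights\<close>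

text \<open>Monotonicity near \<open>1\<close> extends to the whole interval at the price of a constant, because the
remaining part is compact and the function is bounded away from zero and infinity there.\<close>

lemma almost_antimono:
  fixes h :: "real \<Rightarrow> real"
  assumes cont: "continuous_on {0..<1} h" and pos: "\<And>r. r \<in> {0..<1} \<Longrightarrow> 0 < h r"
    and r0: "r0 \<in> {0..<1}" and anti: "antimono_on {r0..<1} h"
  obtains C where "1 \<le> C" and "\<And>r \<rho>. 0 \<le> r \<Longrightarrow> r \<le> \<rho> \<Longrightarrow> \<rho> < 1 \<Longrightarrow> h \<rho> \<le> C * h r"
proof -
  have c: "continuous_on {0..r0} h" using cont r0 by (auto elim: continuous_on_subset)
  obtain x where x: "x \<in> {0..r0}" "\<And>y. y \<in> {0..r0} \<Longrightarrow> h y \<le> h x"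
    using continuous_attains_sup[OF compact_Icc _ c] r0 by auto
  obtain y where y: "y \<in> {0..r0}" "\<And>z. z \<in> {0..r0} \<Longrightarrow> h y \<le> h z"
    using continuous_attains_inf[OF compact_Icc _ c] r0 by auto
  have hy: "0 < h y" using pos y r0 by auto
  have C1: "1 \<le> h x / h y" using y x hy by auto
  have low: "h x \<le> h x / h y * h r" if "r \<in> {0..r0}" for r
  proof -
    have "h x / h y * h y \<le> h x / h y * h r" using y(2)[OF that] C1 by (intro mult_left_mono) auto
    then show ?thesis using hy by simp
  qed
  show thesis
  proof (rule that[OF C1])
    fix r \<rho> :: real assume a: "0 \<le> r" "r \<le> \<rho>" "\<rho> < 1"
    show "h \<rho> \<le> h x / h y * h r"
    proof (cases "r0 \<le> r")
      case True
      then have "h \<rho> \<le> h r" using a anti by (auto simp: monotone_on_def)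
      moreover have "h r \<le> h x / h y * h r"
        using mult_right_mono[OF C1, of "h r"] pos[of r] a by auto
      ultimately show ?thesis by linarith
    next
      case False
      have "h \<rho> \<le> h x"
      proof (cases "r0 \<le> \<rho>")
        case True
        then have "h \<rho> \<le> h r0" using a anti r0 by (auto simp: monotone_on_def)
        then show ?thesis using x(2)[of r0] r0 by auto
      qed (use x(2)[of \<rho>] a in auto)
      then show ?thesis using low[of r] a False by auto
    qed
  qed
qed

text \<open>The form in which normality is used. It holds for all pairs of radii, not only near \<open>1\<close>,
because both monotone quotients are almost monotone on the whole interval; for the
increasing one this is applied to its reciprocal.\<close>

lemma normal_weight_comparison:
  assumes "normal_weight \<phi>"
  obtains s t C where "0 < s" "s < t" "1 \<le> C"
    and "\<And>r \<rho>. 0 \<le> r \<Longrightarrow> r \<le> \<rho> \<Longrightarrow> \<rho> < 1 \<Longrightarrow> \<phi> \<rho> \<le> C * \<phi> r * ((1 - \<rho>) / (1 - r)) powr s"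
    and "\<And>r \<rho>. 0 \<le> r \<Longrightarrow> r \<le> \<rho> \<Longrightarrow> \<rho> < 1 \<Longrightarrow> \<phi> r \<le> C * \<phi> \<rho> * ((1 - r) / (1 - \<rho>)) powr t"
proof -
  from assms obtain s t r0 where st: "0 < s" "s < t" "r0 \<in> {0..<1}"
    and s: "antimono_on {r0..<1} (\<lambda>r. \<phi> r / (1 - r) powr s)"
    and t: "mono_on {r0..<1} (\<lambda>r. \<phi> r / (1 - r) powr t)"
    and c: "continuous_on {0..<1} \<phi>" and pos: "\<And>r. r \<in> {0..<1} \<Longrightarrow> 0 < \<phi> r"
    unfolding normal_weight_def by blast
  obtain C1 where C1: "1 \<le> C1" "\<And>r \<rho>. 0 \<le> r \<Longrightarrow> r \<le> \<rho> \<Longrightarrow> \<rho> < 1 \<Longrightarrow>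
      \<phi> \<rho> / (1 - \<rho>) powr s \<le> C1 * (\<phi> r / (1 - r) powr s)"
    by (rule almost_antimono[OF _ _ st(3) s]) (use pos in \<open>auto intro!: continuous_intros c\<close>)
  have t': "antimono_on {r0..<1} (\<lambda>r. (1 - r) powr t / \<phi> r)"
  proof (rule monotone_onI)
    fix x y assume xy: "x \<in> {r0..<1}" "y \<in> {r0..<1}" "x \<le> y"
    then have "\<phi> x / (1 - x) powr t \<le> \<phi> y / (1 - y) powr t"
      using t by (auto simp: monotone_on_def)
    then show "(1 - x) powr t / \<phi> x \<ge> (1 - y) powr t / \<phi> y"
      using xy st pos[of x] pos[of y] by (auto simp: field_simps)
  qed
  obtain C2 where C2: "1 \<le> C2" "\<And>r \<rho>. 0 \<le> r \<Longrightarrow> r \<le> \<rho> \<Longrightarrow> \<rho> < 1 \<Longrightarrow>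
      (1 - \<rho>) powr t / \<phi> \<rho> \<le> C2 * ((1 - r) powr t / \<phi> r)"
    by (rule almost_antimono[OF _ _ st(3) t'])
      (use pos in \<open>auto intro!: continuous_intros c simp: less_imp_neq[symmetric]\<close>)
  show thesis
  proof (rule that[OF st(1,2), of "max C1 C2"])
    show "1 \<le> max C1 C2" using C1 by simp
    fix r \<rho> :: real assume a: "0 \<le> r" "r \<le> \<rho>" "\<rho> < 1"
    have "\<phi> \<rho> \<le> C1 * (\<phi> r * ((1 - \<rho>) / (1 - r)) powr s)"
      using C1(2)[OF a] a by (simp add: powr_divide field_simps)
    also have "\<dots> \<le> max C1 C2 * (\<phi> r * ((1 - \<rho>) / (1 - r)) powr s)"
      using pos[of r] a by (intro mult_right_mono) auto
    finally show "\<phi> \<rho> \<le> max C1 C2 * \<phi> r * ((1 - \<rho>) / (1 - r)) powr s" by simp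
    have "\<phi> r \<le> C2 * (\<phi> \<rho> * ((1 - r) / (1 - \<rho>)) powr t)"
      using C2(2)[OF a] a pos[of r] pos[of \<rho>] by (simp add: powr_divide field_simps)
    also have "\<dots> \<le> max C1 C2 * (\<phi> \<rho> * ((1 - r) / (1 - \<rho>)) powr t)"
      using pos[of \<rho>] a by (intro mult_right_mono) auto
    finally show "\<phi> r \<le> max C1 C2 * \<phi> \<rho> * ((1 - r) / (1 - \<rho>)) powr t" by simp
  qed
qed

section \<open>Growth of functions in the mixed norm space\<close>

lemma maximum_modulus_disk:
  assumes "f holomorphic_on \<D>" "R < 1" "norm z \<le> R"
    and "\<And>w. norm w = R \<Longrightarrow> norm (f w) \<le> B"
  shows "norm (f z) \<le> B"
proof (rule maximum_modulus_frontier[of f "cball 0 R"])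
  show "f holomorphic_on interior (cball 0 R)"
    using assms(2) by (intro holomorphic_on_subset[OF assms(1)]) auto
  show "continuous_on (closure (cball 0 R)) f"
    using assms(2)
    by (intro holomorphic_on_imp_continuous_on holomorphic_on_subset[OF assms(1)]) auto
qed (use assms in auto)

text \<open>The Cauchy estimate on a disk around \<open>z\<close> needs bounds at points closer to the origin than
\<open>z\<close>; the maximum principle reduces all of them to the circle of radius \<open>(1 + |z|) / 2\<close>.\<close>

lemma norm_deriv_le_disk:
  assumes f: "f holomorphic_on \<D>" and z: "norm z < 1"
    and B: "\<And>w. norm w = (1 + norm z) / 2 \<Longrightarrow> norm (f w) \<le> B"
  shows "norm (deriv f z) \<le> 2 * B / (1 - norm z)"
proof -
  define r where "r = (1 - norm z) / 2"
  have r: "0 < r" using z by (simp add: r_def)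
  have near: "norm w \<le> (1 + norm z) / 2" if "dist z w \<le> r" for w
    using that norm_triangle_ineq2[of w z] by (simp add: dist_norm norm_minus_commute r_def field_simps)
  have sub: "cball z r \<subseteq> \<D>" using near z by force
  have "norm ((deriv ^^ 1) f z) \<le> fact 1 * B / r ^ 1"
  proof (rule Cauchy_inequality[OF _ _ r])
    show "f holomorphic_on ball z r"
      using sub by (intro holomorphic_on_subset[OF f]) (meson ball_subset_cball order_trans)
    show "continuous_on (cball z r) f"
      using sub by (intro holomorphic_on_imp_continuous_on holomorphic_on_subset[OF f])
    fix w assume "norm (z - w) = r"
    then have "norm w \<le> (1 + norm z) / 2" using near by (simp add: dist_norm)
    then show "norm (f w) \<le> B"
      using maximum_modulus_disk[OF f, of "(1 + norm z) / 2" w B] B z by auto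
  qed
  then show ?thesis by (simp add: r_def field_simps)
qed

text \<open>The extremal size at distance \<open>r\<close> from the origin of functions in the unit ball of
\<open>H(p,p,\<phi>)\<close>, up to a constant.\<close>

definition growth :: "real \<Rightarrow> (real \<Rightarrow> real) \<Rightarrow> real \<Rightarrow> real" where
  "growth p \<phi> r = 1 / (\<phi> r * (1 - r\<^sup>2) powr (1 / p))"

text \<open>A ball of the weighted sup-norm space which contains a ball of \<open>H(p,p,\<phi>)\<close>. Unlike the latter
it is visibly closed under pointwise limits, which spares an argument of Fatou type.\<close>

definition growth_class :: "real \<Rightarrow> (real \<Rightarrow> real) \<Rightarrow> real \<Rightarrow> (complex \<Rightarrow> complex) set" where
  "growth_class p \<phi> M = {f \<in> analytic_disk. \<forall>z\<in>\<D>. norm (f z) \<le> M * growth p \<phi> (norm z)}"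

locale mixed_weight =
  fixes p :: real and \<phi> :: "real \<Rightarrow> real"
  assumes p_pos: "0 < p" and normal: "normal_weight \<phi>"
begin

lemma weight_pos: "0 \<le> r \<Longrightarrow> r < 1 \<Longrightarrow> 0 < \<phi> r"
  using normal unfolding normal_weight_def by auto

lemma growth_pos: "0 \<le> r \<Longrightarrow> r < 1 \<Longrightarrow> 0 < growth p \<phi> r"
  using weight_pos[of r] abs_square_less_1[of r] by (auto simp: growth_def)

lemma weight_doubling:
  obtains c where "0 < c"
    and "\<And>r \<rho>. 0 \<le> r \<Longrightarrow> r < 1 \<Longrightarrow> r \<le> \<rho> \<Longrightarrow> \<rho> \<le> (1 + r) / 2 \<Longrightarrow> c * \<phi> r \<le> \<phi> \<rho>"
proof -
  obtain s t C where st: "0 < s" "s < t" "1 \<le> C"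
    and le: "\<And>r \<rho>. 0 \<le> r \<Longrightarrow> r \<le> \<rho> \<Longrightarrow> \<rho> < 1 \<Longrightarrow> \<phi> r \<le> C * \<phi> \<rho> * ((1 - r) / (1 - \<rho>)) powr t"
    using normal_weight_comparison[OF normal] by metis
  show thesis
  proof (rule that[of "1 / (C * 2 powr t)"])
    fix r \<rho> :: real assume a: "0 \<le> r" "r < 1" "r \<le> \<rho>" "\<rho> \<le> (1 + r) / 2"
    have "((1 - r) / (1 - \<rho>)) powr t \<le> 2 powr t"
      using a st by (intro powr_mono2) (auto simp: field_simps)
    then have "C * \<phi> \<rho> * ((1 - r) / (1 - \<rho>)) powr t \<le> C * \<phi> \<rho> * 2 powr t"
      using a st weight_pos[of \<rho>] by (intro mult_left_mono) auto
    with le[of r \<rho>] a have "\<phi> r \<le> C * \<phi> \<rho> * 2 powr t" by auto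
    then show "1 / (C * 2 powr t) * \<phi> r \<le> \<phi> \<rho>" using st by (simp add: field_simps)
  qed (use st in auto)
qed

lemma growth_doubling:
  obtains K where "0 < K"
    and "\<And>r. 0 \<le> r \<Longrightarrow> r < 1 \<Longrightarrow> growth p \<phi> ((1 + r) / 2) \<le> K * growth p \<phi> r"
proof -
  obtain c where c: "0 < c" "\<And>r \<rho>. 0 \<le> r \<Longrightarrow> r < 1 \<Longrightarrow> r \<le> \<rho> \<Longrightarrow> \<rho> \<le> (1 + r) / 2 \<Longrightarrow> c * \<phi> r \<le> \<phi> \<rho>"
    using weight_doubling by metis
  show thesis
  proof (rule that[of "4 powr (1 / p) / c"])
    fix r :: real assume r: "0 \<le> r" "r < 1"
    define \<rho> where "\<rho> = (1 + r) / 2"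
    have \<rho>: "0 \<le> \<rho>" "\<rho> < 1" "r \<le> \<rho>" using r by (auto simp: \<rho>_def)
    have "1 - r\<^sup>2 \<le> 4 * (1 - \<rho>\<^sup>2)"
      using mult_nonneg_nonneg[of "1 - r" 2] r
      by (simp add: \<rho>_def power2_eq_square field_simps)
    then have "(1 - r\<^sup>2) powr (1 / p) \<le> (4 * (1 - \<rho>\<^sup>2)) powr (1 / p)"
      using r p_pos by (intro powr_mono2) (auto simp: power_le_one)
    also have "\<dots> = 4 powr (1 / p) * (1 - \<rho>\<^sup>2) powr (1 / p)"
      using \<rho> by (subst powr_mult) (auto simp: power_le_one)
    finally have "c * \<phi> r * (1 - r\<^sup>2) powr (1 / p) \<le> \<phi> \<rho> * (4 powr (1 / p) * (1 - \<rho>\<^sup>2) powr (1 / p))"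
      using c(2)[of r \<rho>] c(1) weight_pos[of r] weight_pos[of \<rho>] r \<rho>
      by (intro mult_mono) (auto simp: \<rho>_def)
    moreover have "0 < 1 - r\<^sup>2" "0 < 1 - \<rho>\<^sup>2" using r \<rho> by (auto simp: abs_square_less_1)
    ultimately show "growth p \<phi> ((1 + r) / 2) \<le> 4 powr (1 / p) / c * growth p \<phi> r"
      using c(1) weight_pos[of r] weight_pos[of \<rho>] r \<rho> unfolding \<rho>_def[symmetric] growth_def
      by (simp add: field_simps)
  qed (use c in auto)
qed

text \<open>Integrating the local estimate over its interval of radii against the weight. With \<open>R = (1 +
|z|) / 2\<close> all radii lie between \<open>|z|\<close> and \<open>R\<close>, so the weight there is at least a constant
times its value at \<open>|z|\<close>. The bound \<open>1/2 \<le> |z|\<close> is there because the measure \<open>r dr\<close>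
degenerates at the origin.\<close>

lemma mixed_integral_lower_bound:
  obtains c where "0 < c"
    and "\<And>f z. f holomorphic_on \<D> \<Longrightarrow> 1 / 2 \<le> norm z \<Longrightarrow> norm z < 1 \<Longrightarrow>
           ennreal (c * (norm (f z) / growth p \<phi> (norm z)) powr p) \<le> mixed_integral p \<phi> f"
proof -
  obtain C where C: "0 < C" and loc: "\<And>f z R. f holomorphic_on \<D> \<Longrightarrow> norm z < R \<Longrightarrow> R < 1 \<Longrightarrow>
     \<exists>\<alpha> d. norm z \<le> \<alpha> \<and> 0 < d \<and> \<alpha> + d \<le> R \<and> (\<forall>\<rho>\<in>{\<alpha>..\<alpha>+d}.
        (R - norm z)\<^sup>2 * norm (f z) powr p \<le> C * d * circle_mean p f \<rho>)"
    using norm_powr_le_circle_mean_annulus[OF p_pos] by metis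
  obtain b where b: "0 < b" "\<And>r \<rho>. 0 \<le> r \<Longrightarrow> r < 1 \<Longrightarrow> r \<le> \<rho> \<Longrightarrow> \<rho> \<le> (1 + r) / 2 \<Longrightarrow> b * \<phi> r \<le> \<phi> \<rho>"
    using weight_doubling by metis
  show thesis
  proof (rule that[of "b powr p / (16 * C)"])
    fix f :: "complex \<Rightarrow> complex" and z :: complex assume f: "f holomorphic_on \<D>" and z: "1 / 2 \<le> norm z" "norm z < 1"
    define R where "R = (1 + norm z) / 2"
    have R: "norm z < R" "R < 1" using z by (auto simp: R_def)
    obtain \<alpha> d where ad: "norm z \<le> \<alpha>" "0 < d" "\<alpha> + d \<le> R"
      and m: "\<And>\<rho>. \<rho> \<in> {\<alpha>..\<alpha>+d} \<Longrightarrow>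
        (R - norm z)\<^sup>2 * norm (f z) powr p \<le> C * d * circle_mean p f \<rho>"
      using loc[OF f R] by blast
    define X where "X = (R - norm z)\<^sup>2 * norm (f z) powr p / (C * d)"
    define W where "W = (b * \<phi> (norm z)) powr p / (1 - norm z) * (1 / 2)"
    have X0: "0 \<le> X" using C ad by (simp add: X_def)
    have W0: "0 \<le> W" using z by (simp add: W_def)
    have le: "X * W \<le> integral_mean p f \<rho> powr p * (\<phi> \<rho> powr p / (1 - \<rho>) * \<rho>)"
      if \<rho>: "\<rho> \<in> {\<alpha>..\<alpha>+d}" for \<rho>
    proof (rule mult_mono)
      show "X \<le> integral_mean p f \<rho> powr p"
        using m[OF \<rho>] C ad by (simp add: X_def integral_mean_powr[OF p_pos] divide_le_eq mult_ac)
      have r: "norm z \<le> \<rho>" "\<rho> \<le> (1 + norm z) / 2" "\<rho> < 1" using \<rho> ad R by (auto simp: R_def)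
      have "(b * \<phi> (norm z)) powr p \<le> \<phi> \<rho> powr p"
        using b r z p_pos weight_pos[of "norm z"] by (intro powr_mono2) auto
      then show "W \<le> \<phi> \<rho> powr p / (1 - \<rho>) * \<rho>"
        unfolding W_def using r z by (intro mult_mono frac_le) auto
    qed (use W0 in auto)
    have "ennreal (X * W) * ennreal d = (\<integral>\<^sup>+\<rho>\<in>{\<alpha>..\<alpha>+d}. ennreal (X * W) \<partial>lborel)"
      using ad by (simp add: nn_integral_cmult_indicator)
    also have "\<dots> \<le> mixed_integral p \<phi> f"
      unfolding mixed_integral_def
    proof (intro nn_integral_mono)
      fix \<rho>
      show "ennreal (X * W) * indicator {\<alpha>..\<alpha>+d} \<rho> \<le>
        ennreal (integral_mean p f \<rho> powr p * (\<phi> \<rho> powr p / (1 - \<rho>)) * \<rho>) * indicator {0..<1} \<rho>"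
      proof (cases "\<rho> \<in> {\<alpha>..\<alpha>+d}")
        case True
        then have "\<rho> \<in> {0..<1}" using ad R order_trans[OF norm_ge_zero[of z] ad(1)] by auto
        with True show ?thesis using le[OF True] by (simp add: ennreal_leI mult.assoc)
      qed simp
    qed
    finally have "ennreal (X * W * d) \<le> mixed_integral p \<phi> f"
      using X0 W0 by (simp add: ennreal_mult')
    moreover have "b powr p / (16 * C) * (norm (f z) / growth p \<phi> (norm z)) powr p \<le> X * W * d"
    proof -
      have q: "0 \<le> 1 - (norm z)\<^sup>2" using z by (simp add: power_le_one)
      define F where "F = norm (f z) powr p * \<phi> (norm z) powr p"
      have F: "0 \<le> F" by (simp add: F_def)
      have "(norm (f z) / growth p \<phi> (norm z)) powr p =
          (norm (f z) * (\<phi> (norm z) * (1 - (norm z)\<^sup>2) powr (1 / p))) powr p"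
        by (simp add: growth_def)
      also have "\<dots> = F * (1 - (norm z)\<^sup>2)"
        using weight_pos[of "norm z"] z p_pos q by (simp add: F_def powr_mult powr_powr)
      also have "\<dots> \<le> F * (2 * (1 - norm z))"
        using F mult_right_mono[of "norm z" 1 "1 - norm z"] z
        by (intro mult_left_mono) (auto simp: power2_eq_square algebra_simps)
      finally have "b powr p / (16 * C) * (norm (f z) / growth p \<phi> (norm z)) powr p
          \<le> b powr p / (16 * C) * (F * (2 * (1 - norm z)))"
        using C by (intro mult_left_mono) auto
      also have "\<dots> = b powr p / (8 * C) * F * (1 - norm z)"
        using C by (simp add: field_simps)
      also have "\<dots> = X * W * d"
      proof -
        define e where "e = R - norm z"
        have e: "1 - norm z = 2 * e" "0 < e" using z by (auto simp: e_def R_def field_simps)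
        have "(b * \<phi> (norm z)) powr p = b powr p * \<phi> (norm z) powr p"
          by (rule powr_mult)
        then show ?thesis
          using ad(2) C e(2) unfolding X_def W_def F_def e(1) e_def[symmetric]
          by (simp add: power2_eq_square divide_simps)
      qed
      finally show ?thesis .
    qed
    ultimately show "ennreal (b powr p / (16 * C) * (norm (f z) / growth p \<phi> (norm z)) powr p)
        \<le> mixed_integral p \<phi> f"
      by (meson ennreal_leI order_trans)
  qed (use b C in auto)
qed

text \<open>For every \<open>z\<close>, the circle of radius \<open>(1 + |z|) / 2 \<ge> 1/2\<close> lies in the range of the previous
lemma, and the maximum principle together with the doubling property of the growth function
carries the bound from there to \<open>z\<close>.\<close>

lemma mixed_norm_bounded_imp_growth_class:
  obtains K where "0 < K"
    and "\<And>f M. f \<in> mixed_space p \<phi> \<Longrightarrow> mixed_norm p \<phi> f \<le> M \<Longrightarrow> f \<in> growth_class p \<phi> (K * M)"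
proof -
  obtain c where c: "0 < c"
    "\<And>f z. f holomorphic_on \<D> \<Longrightarrow> 1 / 2 \<le> norm z \<Longrightarrow> norm z < 1 \<Longrightarrow>
           ennreal (c * (norm (f z) / growth p \<phi> (norm z)) powr p) \<le> mixed_integral p \<phi> f"
    using mixed_integral_lower_bound by metis
  obtain L where L: "0 < L" "\<And>r. 0 \<le> r \<Longrightarrow> r < 1 \<Longrightarrow> growth p \<phi> ((1 + r) / 2) \<le> L * growth p \<phi> r"
    using growth_doubling by metis
  define a where "a = (1 / c) powr (1 / p)"
  have a: "0 < a" using c by (simp add: a_def)
  show thesis
  proof (rule that[of "a * L"])
    fix f M assume f: "f \<in> mixed_space p \<phi>" and M: "mixed_norm p \<phi> f \<le> M"
    have hol: "f holomorphic_on \<D>" and ana: "f \<in> analytic_disk"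
      and fin: "mixed_integral p \<phi> f < \<infinity>"
      using f by (auto simp: mixed_space_def analytic_disk_def)
    have M0: "0 \<le> M" using M by (simp add: mixed_norm_def) (meson order_trans powr_ge_zero)
    have outer: "norm (f z) \<le> a * M * growth p \<phi> (norm z)" if z: "1 / 2 \<le> norm z" "norm z < 1" for z
    proof -
      have gz: "0 < growth p \<phi> (norm z)" using growth_pos z by simp
      define I where "I = enn2real (mixed_integral p \<phi> f)"
      have "ennreal (c * (norm (f z) / growth p \<phi> (norm z)) powr p) \<le> ennreal I"
        using c(2)[OF hol z] fin by (simp add: I_def)
      then have "c * (norm (f z) / growth p \<phi> (norm z)) powr p \<le> I"
        by (subst (asm) ennreal_le_iff) (auto simp: I_def)
      then have "(norm (f z) / growth p \<phi> (norm z)) powr p \<le> 1 / c * I"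
        using c(1) by (simp add: field_simps)
      then have "((norm (f z) / growth p \<phi> (norm z)) powr p) powr (1 / p) \<le> (1 / c * I) powr (1 / p)"
        using p_pos by (intro powr_mono2) auto
      then have "norm (f z) / growth p \<phi> (norm z) \<le> (1 / c * I) powr (1 / p)"
        using p_pos gz by (simp add: powr_powr)
      also have "\<dots> = a * mixed_norm p \<phi> f"
        unfolding a_def mixed_norm_def I_def by (rule powr_mult)
      also have "\<dots> \<le> a * M" using M a by simp
      finally show ?thesis using gz by (simp add: field_simps)
    qed
    have "norm (f z) \<le> a * L * M * growth p \<phi> (norm z)" if z: "norm z < 1" for z
    proof (rule maximum_modulus_disk[OF hol, of "(1 + norm z) / 2"])
      fix w :: complex assume w: "norm w = (1 + norm z) / 2"
      have "norm (f w) \<le> a * M * growth p \<phi> ((1 + norm z) / 2)"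
        using outer[of w] w z by auto
      also have "\<dots> \<le> a * M * (L * growth p \<phi> (norm z))"
        using L(2)[of "norm z"] z a M0 by (intro mult_left_mono) auto
      finally show "norm (f w) \<le> a * L * M * growth p \<phi> (norm z)" by (simp add: mult_ac)
    qed (use z in auto)
    then show "f \<in> growth_class p \<phi> (a * L * M)"
      using ana by (auto simp: growth_class_def)
  qed (use a L in auto)
qed

lemma growth_class_deriv_bound:
  obtains K where "0 < K"
    and "\<And>f M z. f \<in> growth_class p \<phi> M \<Longrightarrow> norm z < 1 \<Longrightarrow>
           norm (deriv f z) \<le> K * M * growth p \<phi> (norm z) / (1 - (norm z)\<^sup>2)"
proof -
  obtain L where L: "0 < L" "\<And>r. 0 \<le> r \<Longrightarrow> r < 1 \<Longrightarrow> growth p \<phi> ((1 + r) / 2) \<le> L * growth p \<phi> r"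
    using growth_doubling by metis
  show thesis
  proof (rule that[of "4 * L"])
    fix f M z assume f: "f \<in> growth_class p \<phi> M" and z: "norm (z::complex) < 1"
    have hol: "f holomorphic_on \<D>" and g: "\<And>w. norm w < 1 \<Longrightarrow> norm (f w) \<le> M * growth p \<phi> (norm w)"
      using f by (auto simp: growth_class_def analytic_disk_def)
    have "0 \<le> M * growth p \<phi> (norm z)" using g[OF z] norm_ge_zero order_trans by blast
    then have M0: "0 \<le> M" using growth_pos[of "norm z"] z by (simp add: zero_le_mult_iff)
    have "norm (deriv f z) \<le> 2 * (M * L * growth p \<phi> (norm z)) / (1 - norm z)"
    proof (rule norm_deriv_le_disk[OF hol z])
      fix w :: complex assume w: "norm w = (1 + norm z) / 2"
      have "norm (f w) \<le> M * growth p \<phi> ((1 + norm z) / 2)" using g[of w] w z by auto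
      also have "\<dots> \<le> M * (L * growth p \<phi> (norm z))"
        using L(2)[of "norm z"] z M0 by (intro mult_left_mono) auto
      finally show "norm (f w) \<le> M * L * growth p \<phi> (norm z)" by simp
    qed
    also have "\<dots> = 2 * (1 + norm z) * (M * L * growth p \<phi> (norm z)) / (1 - (norm z)\<^sup>2)"
    proof -
      have "1 - (norm z)\<^sup>2 = (1 + norm z) * (1 - norm z)"
        by (simp add: power2_eq_square algebra_simps)
      then show ?thesis using z norm_ge_zero[of z]
        by (simp add: divide_simps del: norm_ge_zero)
    qed
    also have "\<dots> \<le> 4 * (M * L * growth p \<phi> (norm z)) / (1 - (norm z)\<^sup>2)"
      using z M0 L growth_pos[of "norm z"]
      by (intro divide_right_mono mult_right_mono) (auto simp: power_le_one)
    finally show "norm (deriv f z) \<le> 4 * L * M * growth p \<phi> (norm z) / (1 - (norm z)\<^sup>2)"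
      by (simp add: mult_ac)
  qed (use L in auto)
qed

end

section \<open>Mixed norms of functions dominated by a kernel power\<close>

lemma one_minus_cnj_mult_nonzero:
  assumes "norm a < 1" "norm z < 1"
  shows "1 - cnj a * z \<noteq> 0"
proof -
  have "norm (cnj a * z) < 1" using assms norm_mult_less[of "cnj a" 1 z 1] by simp
  then show ?thesis by auto
qed

text \<open>On the circle \<open>|z| = r\<close> one has \<open>cnj z = r\<^sup>2 / z\<close>, which turns \<open>1 / |1 - cnj a z|\<^sup>2\<close> into
the Cauchy integrand of \<open>1 / (1 - cnj a z)\<close> at the point \<open>a r\<^sup>2\<close>.\<close>

lemma circle_mean_Szego_kernel:
  assumes a: "norm a < 1" and r: "0 < r" "r < 1"
  shows "circle_mean 2 (\<lambda>z. 1 / (1 - cnj a * z)) r = 1 / (1 - (norm a * r)\<^sup>2)"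
proof -
  define g where "g = (\<lambda>z. 1 / (1 - cnj a * z))"
  have nz: "1 - cnj a * z \<noteq> 0" if "norm z < 1" for z
    by (rule one_minus_cnj_mult_nonzero[OF a that])
  have g: "g holomorphic_on \<D>"
    unfolding g_def using nz by (intro holomorphic_intros) auto
  have nw: "norm (a * of_real (r\<^sup>2)) < r"
    using mult_strict_mono[OF a r(2), of] r by (simp add: norm_mult power2_eq_square)
  have C: "((\<lambda>t. g (of_real r * cis t) / (of_real r * cis t - a * of_real (r\<^sup>2)) * (of_real r * cis t))
      has_integral (2 * of_real pi * g (a * of_real (r\<^sup>2)))) {0..2*pi}"
    by (rule Cauchy_circle_integral[OF g nw r(2)])
  have "g (of_real r * cis t) / (of_real r * cis t - a * of_real (r\<^sup>2)) * (of_real r * cis t)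
      = of_real (norm (g (of_real r * cis t)) powr 2)" for t
  proof -
    define z where "z = of_real r * cis t"
    have z: "norm z = r" using r by (simp add: z_def norm_mult)
    then have z0: "z \<noteq> 0" "norm z < 1" using r by auto
    have zz: "of_real (r\<^sup>2) = z * cnj z" using z complex_norm_square[of z] by simp
    have "g z / (z - a * of_real (r\<^sup>2)) * z = 1 / (1 - cnj a * z) * (1 / (1 - a * cnj z))"
      unfolding g_def zz using z0 nz[OF z0(2)]
      by (simp add: divide_simps) (simp add: algebra_simps)
    also have "1 / (1 - a * cnj z) = cnj (1 / (1 - cnj a * z))" by simp
    also have "1 / (1 - cnj a * z) * cnj (1 / (1 - cnj a * z)) = of_real ((norm (1 / (1 - cnj a * z)))\<^sup>2)"
      by (rule complex_norm_square[symmetric])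
    finally show ?thesis unfolding z_def[symmetric] by (simp add: g_def)
  qed
  with C have "((\<lambda>t. of_real (norm (g (of_real r * cis t)) powr 2)) has_integral
      (2 * of_real pi * g (a * of_real (r\<^sup>2)))) {0..2*pi}" by simp
  moreover have "g (a * of_real (r\<^sup>2)) = of_real (1 / (1 - (norm a * r)\<^sup>2))"
    using complex_norm_square[of a] by (simp add: g_def power_mult_distrib mult_ac)
  ultimately have "((\<lambda>t. complex_of_real (norm (g (of_real r * cis t)) powr 2)) has_integral
      of_real (2 * pi * (1 / (1 - (norm a * r)\<^sup>2)))) {0..2*pi}"
    by simp
  from has_integral_linear[OF this bounded_linear_Re]
  have "((\<lambda>t. norm (g (of_real r * cis t)) powr 2) has_integral
      2 * pi * (1 / (1 - (norm a * r)\<^sup>2))) {0..2*pi}"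
    by (simp add: o_def)
  from integral_unique[OF this] show ?thesis
    using circle_mean_eq_integral(2)[OF g, of r 2] r by (simp add: g_def)
qed

lemma nn_integral_one_minus_powr_tail:
  assumes "0 < e" "0 \<le> \<rho>" "\<rho> < 1"
  shows "(\<integral>\<^sup>+r\<in>{\<rho>..1}. ennreal ((1 - r) powr (e - 1)) \<partial>lborel) = ennreal ((1 - \<rho>) powr e / e)"
proof -
  have "((\<lambda>r. (1 - r) powr (e - 1)) has_integral
      (- ((1 - 1) powr e / e) - - ((1 - \<rho>) powr e / e))) {\<rho>..1}"
  proof (rule fundamental_theorem_of_calculus_interior_strong[of "{}"])
    fix x assume "x \<in> {\<rho><..<1} - {}"
    then show "((\<lambda>r. - ((1 - r) powr e / e)) has_vector_derivative (1 - x) powr (e - 1)) (at x)"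
      unfolding has_real_derivative_iff_has_vector_derivative[symmetric] using assms
      by (auto intro!: derivative_eq_intros simp: powr_diff)
  next
    show "continuous_on {\<rho>..1} (\<lambda>r. - ((1 - r) powr e / e))"
      using assms by (intro continuous_intros continuous_on_powr') auto
  qed (use assms in auto)
  then have "((\<lambda>r. (1 - r) powr (e - 1)) has_integral (1 - \<rho>) powr e / e) {\<rho>..1}"
    using assms by simp
  from nn_integral_has_integral_lebesgue[OF _ this] show ?thesis
    by (simp add: ennreal_mult' ennreal_indicator mult.commute)
qed

lemma nn_integral_one_minus_powr_head:
  assumes "0 < e" "0 \<le> \<rho>" "\<rho> < 1"
  shows "(\<integral>\<^sup>+r\<in>{0..\<rho>}. ennreal ((1 - r) powr (- e - 1)) \<partial>lborel) \<le> ennreal ((1 - \<rho>) powr (- e) / e)"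
proof -
  have "((\<lambda>r. (1 - r) powr (- e - 1)) has_integral
      ((1 - \<rho>) powr (- e) / e - (1 - 0) powr (- e) / e)) {0..\<rho>}"
  proof (rule fundamental_theorem_of_calculus)
    fix x assume "x \<in> {0..\<rho>}"
    then have "((\<lambda>r. (1 - r) powr (- e) / e) has_vector_derivative (1 - x) powr (- e - 1)) (at x)"
      unfolding has_real_derivative_iff_has_vector_derivative[symmetric] using assms
      by (auto intro!: derivative_eq_intros simp: powr_diff)
    then show "((\<lambda>r. (1 - r) powr (- e) / e) has_vector_derivative (1 - x) powr (- e - 1))
        (at x within {0..\<rho>})"
      by (rule has_vector_derivative_at_within)
  qed (use assms in auto)
  from nn_integral_has_integral_lebesgue[OF _ this]
  have "(\<integral>\<^sup>+r\<in>{0..\<rho>}. ennreal ((1 - r) powr (- e - 1)) \<partial>lborel)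
      = ennreal ((1 - \<rho>) powr (- e) / e - (1 - 0) powr (- e) / e)"
    by (simp add: ennreal_mult' ennreal_indicator mult.commute)
  also have "\<dots> \<le> ennreal ((1 - \<rho>) powr (- e) / e)"
    using assms by (intro ennreal_leI) simp
  finally show ?thesis .
qed

text \<open>The two majorants are the contributions of the radii beyond \<open>\<rho>\<close> and before \<open>\<rho>\<close>. Each is
normalised so that its integral does not depend on \<open>\<rho>\<close>.\<close>

lemma weighted_kernel_integral:
  assumes "0 < e1" "0 < e2" "0 \<le> \<rho>" "\<rho> < 1" "0 \<le> B"
    and hi: "\<And>r. \<rho> \<le> r \<Longrightarrow> r < 1 \<Longrightarrow> h r \<le> B * ((1 - \<rho>) powr (- e1) * (1 - r) powr (e1 - 1))"
    and lo: "\<And>r. 0 \<le> r \<Longrightarrow> r < \<rho> \<Longrightarrow> h r \<le> B * ((1 - \<rho>) powr e2 * (1 - r) powr (- e2 - 1))"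
  shows "(\<integral>\<^sup>+r\<in>{0..<1}. ennreal (h r) \<partial>lborel) \<le> ennreal (B * (1 / e1 + 1 / e2))"
proof -
  define h1 where "h1 = (\<lambda>r. ennreal ((1 - r) powr (e1 - 1)) * indicator {\<rho>..1} r)"
  define h2 where "h2 = (\<lambda>r. ennreal ((1 - r) powr (- e2 - 1)) * indicator {0..\<rho>} r)"
  define b1 where "b1 = ennreal (B * (1 - \<rho>) powr (- e1))"
  define b2 where "b2 = ennreal (B * (1 - \<rho>) powr e2)"
  have "(\<integral>\<^sup>+r\<in>{0..<1}. ennreal (h r) \<partial>lborel) \<le> (\<integral>\<^sup>+r. b1 * h1 r + b2 * h2 r \<partial>lborel)"
  proof (rule nn_integral_mono)
    fix r
    have "ennreal (h r) \<le> b1 * h1 r" if "\<rho> \<le> r" "r < 1"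
      using ennreal_leI[OF hi[OF that]] that assms
      by (simp add: b1_def h1_def mult.assoc flip: ennreal_mult'')
    moreover have "ennreal (h r) \<le> b2 * h2 r" if "0 \<le> r" "r < \<rho>"
      using ennreal_leI[OF lo[OF that]] that assms
      by (simp add: b2_def h2_def mult.assoc flip: ennreal_mult'')
    ultimately show "ennreal (h r) * indicator {0..<1} r \<le> b1 * h1 r + b2 * h2 r"
      by (cases "r \<in> {0..<1}"; cases "\<rho> \<le> r") (auto intro: add_increasing add_increasing2)
  qed
  also have "\<dots> = b1 * (\<integral>\<^sup>+r. h1 r \<partial>lborel) + b2 * (\<integral>\<^sup>+r. h2 r \<partial>lborel)"
    unfolding h1_def h2_def
    by (subst nn_integral_add) (auto simp: nn_integral_cmult)
  also have "\<dots> \<le> b1 * ennreal ((1 - \<rho>) powr e1 / e1) + b2 * ennreal ((1 - \<rho>) powr (- e2) / e2)"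
    unfolding h1_def h2_def using assms
    by (intro add_mono mult_left_mono nn_integral_one_minus_powr_head
        eq_refl[OF nn_integral_one_minus_powr_tail]) auto
  also have "\<dots> = ennreal (B * (1 - \<rho>) powr (- e1) * ((1 - \<rho>) powr e1 / e1) +
      B * (1 - \<rho>) powr e2 * ((1 - \<rho>) powr (- e2) / e2))"
    unfolding b1_def b2_def using assms by (simp flip: ennreal_mult'' ennreal_plus)
  also have "\<dots> = ennreal (B * (1 / e1 + 1 / e2))"
    using assms by (simp add: powr_minus field_simps)
  finally show ?thesis .
qed

context mixed_weight
begin

text \<open>Test functions with the modulus of a high power of the kernel are as small in \<open>H(p,p,\<phi>)\<close> as
their value at \<open>a\<close> permits. The \<open>p\<close>-mean over the circle of radius \<open>r\<close> is of the order \<open>(1 -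
|a|)\<^sup>q (1 - |a| r)\<^bsup>1-q\<^esup>\<close> with \<open>q = p N\<close>. For radii beyond \<open>|a|\<close> its second factor is at most
\<open>(1 - |a|)\<^bsup>1-q\<^esup>\<close> and the decay exponent \<open>s\<close> of the weight makes the integral converge; for
smaller radii the weight is at most of order \<open>((1 - r) / (1 - |a|))\<^sup>t\<close> times \<open>\<phi>(|a|)\<close>, and
the second factor is at most \<open>(1 - r)\<^bsup>1-q\<^esup>\<close>, so that \<open>q > t p + 1\<close> suffices.\<close>

lemma mixed_integral_upper_bound:
  obtains N :: nat and C where "0 < C"
    and "\<And>f a K. f holomorphic_on \<D> \<Longrightarrow> norm a < 1 \<Longrightarrow> 0 \<le> K \<Longrightarrow>
        (\<And>z. norm z < 1 \<Longrightarrow> norm (f z) \<le> K * ((1 - (norm a)\<^sup>2) / norm (1 - cnj a * z)) ^ N) \<Longrightarrow>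
        mixed_integral p \<phi> f \<le> ennreal (C * (K / growth p \<phi> (norm a)) powr p)"
proof -
  obtain s t C1 where st: "0 < s" "s < t" "1 \<le> C1"
    and up: "\<And>r \<rho>. 0 \<le> r \<Longrightarrow> r \<le> \<rho> \<Longrightarrow> \<rho> < 1 \<Longrightarrow> \<phi> \<rho> \<le> C1 * \<phi> r * ((1 - \<rho>) / (1 - r)) powr s"
    and dn: "\<And>r \<rho>. 0 \<le> r \<Longrightarrow> r \<le> \<rho> \<Longrightarrow> \<rho> < 1 \<Longrightarrow> \<phi> r \<le> C1 * \<phi> \<rho> * ((1 - r) / (1 - \<rho>)) powr t"
    using normal_weight_comparison[OF normal] by metis
  \<comment> \<open>This makes \<open>p N\<close> at least \<open>t p + 2\<close>, hence larger than both \<open>t p + 1\<close> and \<open>2\<close>.\<close>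
  define N where "N = nat \<lceil>(t * p + 2) / p\<rceil>"
  define q where "q = p * real N"
  have "(t * p + 2) / p \<le> real N" unfolding N_def by linarith
  then have q: "t * p + 2 \<le> q" using p_pos by (simp add: q_def field_simps)
  have tp: "0 < t * p" "0 < s * p" using st p_pos by auto
  have q2: "2 \<le> q" using q tp by linarith
  then have N: "0 < N" by (cases "N = 0") (auto simp: q_def)
  define e1 where "e1 = s * p"
  define e2 where "e2 = q - t * p - 1"
  have e: "0 < e1" "0 < e2" using tp q by (auto simp: e1_def e2_def)
  define D where "D = C1 powr p * 2 powr q * (1 / e1 + 1 / e2)"
  show thesis
  proof (rule that[of D N])
    show "0 < D" using e st by (simp add: D_def add_pos_pos)
    fix f :: "complex \<Rightarrow> complex" and a :: complex and K :: real
    assume f: "f holomorphic_on \<D>" and a: "norm a < 1" and K: "0 \<le> K"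
      and le: "\<And>z. norm z < 1 \<Longrightarrow> norm (f z) \<le> K * ((1 - (norm a)\<^sup>2) / norm (1 - cnj a * z)) ^ N"
    define \<rho> where "\<rho> = norm a"
    have \<rho>: "0 \<le> \<rho>" "\<rho> < 1" using a by (auto simp: \<rho>_def)
    have \<rho>2: "0 < 1 - \<rho>\<^sup>2" using \<rho> by (simp add: abs_square_less_1)
    define g where "g = (\<lambda>z. 1 / (1 - cnj a * z))"
    have low: "1 - \<rho> * norm z \<le> norm (1 - cnj a * z)" for z
      using norm_triangle_ineq2[of 1 "cnj a * z"] by (simp add: \<rho>_def norm_mult)
    have rr: "0 < 1 - \<rho> * r" if "0 \<le> r" "r < 1" for r
      using that \<rho> mult_right_le_one_le[of \<rho> r] by simp
    have g: "g holomorphic_on \<D>"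
      unfolding g_def using one_minus_cnj_mult_nonzero[OF a] by (intro holomorphic_intros) auto
    \<comment> \<open>All but two of the powers of the kernel are estimated by its maximum on the circle.\<close>
    have mean: "circle_mean p f r \<le> K powr p * (1 - \<rho>\<^sup>2) powr q * (1 - \<rho> * r) powr (1 - q)"
      if r: "0 < r" "r < 1" for r
    proof -
      have R: "0 < 1 - \<rho> * r" using rr[of r] r by simp
      have "circle_mean p f r \<le>
        K powr p * (1 - \<rho>\<^sup>2) powr q * (1 - \<rho> * r) powr (2 - q) * circle_mean 2 g r"
      proof (rule circle_mean_mono[OF f g])
        fix w :: complex assume w: "norm w = r"
        have gw: "norm (g w) = 1 / norm (1 - cnj a * w)" by (simp add: g_def norm_divide)
        have pos: "0 < norm (1 - cnj a * w)"
          using one_minus_cnj_mult_nonzero[OF a, of w] w r by simp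
        have "norm (f w) \<le> K * ((1 - \<rho>\<^sup>2) * norm (g w)) ^ N"
          using le[of w] w r by (simp add: gw \<rho>_def)
        then have "norm (f w) powr p \<le> (K * ((1 - \<rho>\<^sup>2) * norm (g w)) ^ N) powr p"
          using p_pos by (intro powr_mono2) auto
        also have "\<dots> = K powr p * (((1 - \<rho>\<^sup>2) * norm (g w)) powr real N) powr p"
          using \<rho>2 N powr_realpow'[of "(1 - \<rho>\<^sup>2) * norm (g w)" N] by (simp add: powr_mult)
        also have "\<dots> = K powr p * (1 - \<rho>\<^sup>2) powr q * norm (g w) powr q"
          by (simp add: powr_powr q_def mult.commute powr_mult)
        also have "norm (g w) powr q = norm (g w) powr (q - 2) * norm (g w) powr 2"
          using powr_add[of "norm (g w)" "q - 2" 2] by simp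
        also have "norm (g w) powr (q - 2) \<le> (1 - \<rho> * r) powr (2 - q)"
        proof -
          have "norm (g w) powr (q - 2) \<le> (1 / (1 - \<rho> * r)) powr (q - 2)"
            using low[of w] w R q2 pos by (intro powr_mono2) (auto simp: gw intro!: frac_le)
          also have "\<dots> = (1 - \<rho> * r) powr (2 - q)"
            using R by (simp add: powr_divide powr_diff)
          finally show ?thesis .
        qed
        finally show "norm (f w) powr p \<le>
            K powr p * (1 - \<rho>\<^sup>2) powr q * (1 - \<rho> * r) powr (2 - q) * norm (g w) powr 2"
          by (simp add: mult_left_mono mult_right_mono mult.assoc)
      qed (use r p_pos in auto)
      also have "circle_mean 2 g r \<le> 1 / (1 - \<rho> * r)"
      proof -
        have "\<rho> * r < 1" "0 \<le> \<rho> * r" using R \<rho> r by auto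
        then have "(\<rho> * r)\<^sup>2 \<le> \<rho> * r" by (simp add: power2_eq_square mult_left_le_one_le)
        with R show ?thesis
          unfolding g_def circle_mean_Szego_kernel[OF a r] \<rho>_def[symmetric]
          by (intro frac_le) auto
      qed
      also have "K powr p * (1 - \<rho>\<^sup>2) powr q * (1 - \<rho> * r) powr (2 - q) * (1 / (1 - \<rho> * r))
          = K powr p * (1 - \<rho>\<^sup>2) powr q * (1 - \<rho> * r) powr (1 - q)"
        using R by (simp add: powr_diff power2_eq_square field_simps)
      finally show ?thesis by (simp add: mult_left_mono)
    qed
    define A where "A = K powr p * (1 - \<rho>\<^sup>2) powr q"
    have A: "0 \<le> A" by (simp add: A_def)
    define h where "h = (\<lambda>r. integral_mean p f r powr p * (\<phi> r powr p / (1 - r)) * r)"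
    have h: "h r \<le> A * ((1 - \<rho> * r) powr (1 - q) * (\<phi> r powr p / (1 - r)))" if r: "0 \<le> r" "r < 1" for r
    proof (cases "r = 0")
      case False
      have "h r = circle_mean p f r * (\<phi> r powr p / (1 - r)) * r"
        by (simp add: h_def integral_mean_powr[OF p_pos])
      also have "\<dots> \<le> circle_mean p f r * (\<phi> r powr p / (1 - r))"
        using r circle_mean_nonneg[of p f r] by (intro mult_left_le mult_nonneg_nonneg) auto
      also have "\<dots> \<le> A * (1 - \<rho> * r) powr (1 - q) * (\<phi> r powr p / (1 - r))"
        using mean[of r] r False by (intro mult_right_mono) (auto simp: A_def)
      finally show ?thesis by (simp add: mult.assoc)
    qed (use A in \<open>simp add: h_def\<close>)
    define B where "B = A * (C1 * \<phi> \<rho>) powr p * (1 - \<rho>) powr (1 - q)"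
    have B: "0 \<le> B" using A by (simp add: B_def)
    have "mixed_integral p \<phi> f = (\<integral>\<^sup>+r\<in>{0..<1}. ennreal (h r) \<partial>lborel)"
      by (simp add: mixed_integral_def h_def)
    also have "\<dots> \<le> ennreal (B * (1 / e1 + 1 / e2))"
    proof (rule weighted_kernel_integral[OF e \<rho> B])
      fix r assume r: "\<rho> \<le> r" "r < 1"
      have r0: "0 \<le> r" using r \<rho> by simp
      have "\<phi> r powr p \<le> (C1 * \<phi> \<rho> * ((1 - r) / (1 - \<rho>)) powr s) powr p"
        using up[OF \<rho>(1) r] weight_pos[OF r0 r(2)] p_pos by (intro powr_mono2) auto
      also have "\<dots> = (C1 * \<phi> \<rho>) powr p * ((1 - \<rho>) powr (- e1) * (1 - r) powr e1)"
        using r \<rho> by (simp add: powr_mult powr_divide powr_powr e1_def powr_minus field_simps)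
      finally have ph: "\<phi> r powr p / (1 - r) \<le>
          (C1 * \<phi> \<rho>) powr p * ((1 - \<rho>) powr (- e1) * (1 - r) powr e1) / (1 - r)"
        using r by (intro divide_right_mono) auto
      have "(1 - \<rho> * r) powr (1 - q) \<le> (1 - \<rho>) powr (1 - q)"
        using r \<rho> r0 q2 by (intro powr_mono2') (auto simp: mult_left_le)
      then have "(1 - \<rho> * r) powr (1 - q) * (\<phi> r powr p / (1 - r)) \<le> (1 - \<rho>) powr (1 - q) *
          ((C1 * \<phi> \<rho>) powr p * ((1 - \<rho>) powr (- e1) * (1 - r) powr e1) / (1 - r))"
        using ph r by (intro mult_mono) auto
      then have "h r \<le> A * ((1 - \<rho>) powr (1 - q) *
          ((C1 * \<phi> \<rho>) powr p * ((1 - \<rho>) powr (- e1) * (1 - r) powr e1) / (1 - r)))"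
        using h[OF r0 r(2)] A by (meson mult_left_mono order_trans)
      then show "h r \<le> B * ((1 - \<rho>) powr (- e1) * (1 - r) powr (e1 - 1))"
        using r by (simp add: B_def powr_diff mult_ac)
    next
      fix r assume r: "0 \<le> r" "r < \<rho>"
      have r1: "r < 1" using r \<rho> by simp
      have "\<phi> r powr p \<le> (C1 * \<phi> \<rho> * ((1 - r) / (1 - \<rho>)) powr t) powr p"
        using dn[OF r(1) _ \<rho>(2)] r weight_pos[OF r(1) r1] p_pos by (intro powr_mono2) auto
      also have "\<dots> = (C1 * \<phi> \<rho>) powr p * ((1 - \<rho>) powr (- (t * p)) * (1 - r) powr (t * p))"
        using r \<rho> by (simp add: powr_mult powr_divide powr_powr powr_minus field_simps)
      finally have ph: "\<phi> r powr p / (1 - r) \<le>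
          (C1 * \<phi> \<rho>) powr p * ((1 - \<rho>) powr (- (t * p)) * (1 - r) powr (t * p)) / (1 - r)"
        using r1 by (intro divide_right_mono) auto
      have "(1 - \<rho> * r) powr (1 - q) \<le> (1 - r) powr (1 - q)"
        using r r1 \<rho> q2 by (intro powr_mono2') (auto simp: mult_left_le_one_le)
      then have "(1 - \<rho> * r) powr (1 - q) * (\<phi> r powr p / (1 - r)) \<le> (1 - r) powr (1 - q) *
          ((C1 * \<phi> \<rho>) powr p * ((1 - \<rho>) powr (- (t * p)) * (1 - r) powr (t * p)) / (1 - r))"
        using ph r1 by (intro mult_mono) auto
      then have "h r \<le> A * ((1 - r) powr (1 - q) *
          ((C1 * \<phi> \<rho>) powr p * ((1 - \<rho>) powr (- (t * p)) * (1 - r) powr (t * p)) / (1 - r)))"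
        using h[OF r(1) r1] A by (meson mult_left_mono order_trans)
      also have "\<dots> = A * (C1 * \<phi> \<rho>) powr p * (1 - \<rho>) powr (- (t * p)) *
          ((1 - r) powr (1 - q) * (1 - r) powr (t * p) / (1 - r))"
        by simp
      also have "(1 - \<rho>) powr (- (t * p)) = (1 - \<rho>) powr (1 - q) * (1 - \<rho>) powr e2"
        by (simp add: e2_def flip: powr_add)
      also have "(1 - r) powr (1 - q) * (1 - r) powr (t * p) / (1 - r) = (1 - r) powr (- e2 - 1)"
        using r1 by (simp add: e2_def powr_diff powr_add powr_minus field_simps)
      finally show "h r \<le> B * ((1 - \<rho>) powr e2 * (1 - r) powr (- e2 - 1))"
        by (simp add: B_def mult_ac)
    qed
    also have "\<dots> \<le> ennreal (D * (K / growth p \<phi> (norm a)) powr p)"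
    proof (rule ennreal_leI)
      have pos: "0 < \<phi> \<rho>" using weight_pos \<rho> by simp
      have "(K / growth p \<phi> (norm a)) powr p = K powr p * \<phi> \<rho> powr p * (1 - \<rho>\<^sup>2)"
        using p_pos \<rho>2 by (simp add: growth_def \<rho>_def[symmetric] powr_mult powr_powr)
      then have rhs: "D * (K / growth p \<phi> (norm a)) powr p =
          (C1 powr p * K powr p * \<phi> \<rho> powr p * (1 / e1 + 1 / e2)) * (2 powr q * (1 - \<rho>\<^sup>2))"
        by (simp add: D_def mult_ac)
      have "(1 - \<rho>\<^sup>2) powr q * (1 - \<rho>) powr (1 - q) \<le> 2 powr q * (1 - \<rho>\<^sup>2)"
      proof -
        have "1 - \<rho>\<^sup>2 = (1 + \<rho>) * (1 - \<rho>)" by (simp add: power2_eq_square algebra_simps)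
        then have "(1 - \<rho>\<^sup>2) powr q * (1 - \<rho>) powr (1 - q) =
            (1 + \<rho>) powr q * ((1 - \<rho>) powr q * (1 - \<rho>) powr (1 - q))"
          by (simp add: powr_mult)
        also have "(1 - \<rho>) powr q * (1 - \<rho>) powr (1 - q) = 1 - \<rho>"
          using \<rho> by (simp flip: powr_add)
        also have "(1 + \<rho>) powr q * (1 - \<rho>) \<le> 2 powr q * (1 - \<rho>\<^sup>2)"
          using \<rho> q2 by (intro mult_mono powr_mono2)
            (auto simp: power2_eq_square mult_left_le)
        finally show ?thesis .
      qed
      from mult_left_mono[OF this, of "C1 powr p * K powr p * \<phi> \<rho> powr p * (1 / e1 + 1 / e2)"] e
      show "B * (1 / e1 + 1 / e2) \<le> D * (K / growth p \<phi> (norm a)) powr p"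
        unfolding rhs by (simp add: B_def A_def powr_mult mult_ac)
    qed
    finally show "mixed_integral p \<phi> f \<le> ennreal (D * (K / growth p \<phi> (norm a)) powr p)" .
  qed
qed

end

section \<open>Sufficiency: normal families\<close>

lemma eventually_to_circle:
  "eventually P to_circle \<longleftrightarrow> (\<exists>b. 0 \<le> b \<and> b < 1 \<and> (\<forall>z. b < norm z \<longrightarrow> norm z < 1 \<longrightarrow> P z))"
proof
  assume "eventually P to_circle"
  then obtain Q where Q: "eventually Q (at_left 1)" "\<And>z. Q (norm z) \<Longrightarrow> P z"
    unfolding to_circle_def eventually_filtercomap by blast
  then obtain b where "b < 1" "\<And>y. b < y \<Longrightarrow> y < 1 \<Longrightarrow> Q y"
    unfolding eventually_at_left_field by blast
  then show "\<exists>b. 0 \<le> b \<and> b < 1 \<and> (\<forall>z. b < norm z \<longrightarrow> norm z < 1 \<longrightarrow> P z)"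
    using Q(2) by (intro exI[of _ "max 0 b"]) auto
next
  assume "\<exists>b. 0 \<le> b \<and> b < 1 \<and> (\<forall>z. b < norm z \<longrightarrow> norm z < 1 \<longrightarrow> P z)"
  then obtain b where "b < 1" "\<And>z. b < norm z \<Longrightarrow> norm z < 1 \<Longrightarrow> P z" by blast
  then show "eventually P to_circle"
    unfolding to_circle_def eventually_filtercomap eventually_at_left_field
    by (intro exI[of _ "\<lambda>y. b < y \<and> y < 1"]) auto
qed

lemma bloch_seminorm_le:
  assumes "\<And>z. norm z < 1 \<Longrightarrow> (1 - (norm z)\<^sup>2) * norm (deriv h z) \<le> B"
  shows "bloch_seminorm h \<le> ennreal B"
  unfolding bloch_seminorm_def using assms by (intro SUP_least ennreal_leI) auto

lemma bloch_norm_le: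
  assumes "\<And>z. norm z < 1 \<Longrightarrow> (1 - (norm z)\<^sup>2) * norm (deriv h z) \<le> B"
  shows "bloch_norm h \<le> norm (h 0) + B"
proof -
  have "0 \<le> B" using assms[of 0] by (simp) (meson norm_ge_zero order_trans)
  then have "enn2real (bloch_seminorm h) \<le> B"
    using bloch_seminorm_le[OF assms] by (intro enn2real_leI) auto
  then show ?thesis by (simp add: bloch_norm_def)
qed

lemma deriv_le_bloch_seminorm:
  assumes "bloch_seminorm h < \<infinity>" "norm z < 1"
  shows "(1 - (norm z)\<^sup>2) * norm (deriv h z) \<le> enn2real (bloch_seminorm h)"
proof -
  have "ennreal ((1 - (norm z)\<^sup>2) * norm (deriv h z)) \<le> bloch_seminorm h"
    unfolding bloch_seminorm_def using assms(2) by (intro SUP_upper) auto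
  also have "\<dots> = ennreal (enn2real (bloch_seminorm h))" using assms(1) by simp
  finally show ?thesis by (subst (asm) ennreal_le_iff) auto
qed

lemma holomorphic_bounded_cball:
  assumes "f holomorphic_on \<D>" "b < 1"
  obtains B where "0 < B" and "\<And>z. norm z \<le> b \<Longrightarrow> norm (f z) \<le> B"
proof -
  have "compact (f ` cball 0 b)"
    using assms(2)
    by (intro compact_continuous_image holomorphic_on_imp_continuous_on
        holomorphic_on_subset[OF assms(1)]) auto
  then obtain B where "0 < B" "\<And>w. w \<in> f ` cball 0 b \<Longrightarrow> norm w \<le> B"
    using compact_imp_bounded bounded_pos by metis
  then show thesis by (intro that[of B]) auto
qed

lemma little_bloch_spaceI:
  assumes h: "h \<in> analytic_disk"
    and lim: "((\<lambda>z. (1 - (norm z)\<^sup>2) * norm (deriv h z)) \<longlongrightarrow> 0) to_circle"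
  shows "h \<in> little_bloch_space"
proof -
  have "eventually (\<lambda>z. (1 - (norm z)\<^sup>2) * norm (deriv h z) < 1) to_circle"
    using order_tendstoD(2)[OF lim, of 1] by simp
  then obtain b where b: "0 \<le> b" "b < 1"
    "\<And>z. b < norm z \<Longrightarrow> norm z < 1 \<Longrightarrow> (1 - (norm z)\<^sup>2) * norm (deriv h z) < 1"
    unfolding eventually_to_circle by blast
  have "deriv h holomorphic_on \<D>"
    using h by (intro holomorphic_deriv) (auto simp: analytic_disk_def)
  then obtain B where B: "0 < B" "\<And>z. norm z \<le> b \<Longrightarrow> norm (deriv h z) \<le> B"
    using holomorphic_bounded_cball b(2) by metis
  have "bloch_seminorm h \<le> ennreal (max 1 B)"
  proof (rule bloch_seminorm_le)
    fix z :: complex assume z: "norm z < 1"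
    show "(1 - (norm z)\<^sup>2) * norm (deriv h z) \<le> max 1 B"
    proof (cases "b < norm z")
      case False
      have "(1 - (norm z)\<^sup>2) * norm (deriv h z) \<le> 1 * norm (deriv h z)"
        by (intro mult_right_mono) auto
      then show ?thesis using B(2)[of z] False by auto
    qed (use b(3)[of z] z in auto)
  qed
  then have "bloch_seminorm h < \<infinity>" using le_less_trans by fastforce
  then show ?thesis using h lim by (simp add: little_bloch_space_def bloch_space_def)
qed

locale mixed_weight_composition = mixed_weight +
  fixes \<psi> u :: "complex \<Rightarrow> complex"
  assumes \<psi>_hol: "\<psi> holomorphic_on \<D>" and \<psi>_self: "\<psi> ` \<D> \<subseteq> \<D>" and u_hol: "u holomorphic_on \<D>"
begin

abbreviation T :: "(complex \<Rightarrow> complex) \<Rightarrow> complex \<Rightarrow> complex" where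
  "T \<equiv> weighted_composition u \<psi>"

text \<open>The sizes of the two terms of the derivative of the image of \<open>f\<close>, weighted by \<open>1 - |z|\<^sup>2\<close>,
when \<open>|f|\<close> and \<open>|f'|\<close> at \<open>\<psi>(z)\<close> are replaced by their extremal orders \<open>\<omega>(r)\<close> and \<open>\<omega>(r) / (1
- r\<^sup>2)\<close>, \<open>r = |\<psi>(z)|\<close>. They are the quotients of the theorem.\<close>

definition value_factor :: "complex \<Rightarrow> real" where
  "value_factor z = (1 - (norm z)\<^sup>2) * norm (deriv u z) * growth p \<phi> (norm (\<psi> z))"

definition slope_factor :: "complex \<Rightarrow> real" where
  "slope_factor z = (1 - (norm z)\<^sup>2) * norm (u z * deriv \<psi> z) * growth p \<phi> (norm (\<psi> z)) / (1 - (norm (\<psi> z))\<^sup>2)"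

lemma norm_\<psi>: "norm z < 1 \<Longrightarrow> norm (\<psi> z) < 1"
  using \<psi>_self by (simp add: image_subset_iff)

lemma value_factor_nonneg: "norm z < 1 \<Longrightarrow> 0 \<le> value_factor z"
  using growth_pos[of "norm (\<psi> z)"] norm_\<psi>[of z] by (simp add: value_factor_def power_le_one)

lemma slope_factor_nonneg: "norm z < 1 \<Longrightarrow> 0 \<le> slope_factor z"
  using growth_pos[of "norm (\<psi> z)"] norm_\<psi>[of z] by (simp add: slope_factor_def power_le_one)

lemma T_analytic:
  assumes "f \<in> analytic_disk"
  shows "T f \<in> analytic_disk"
proof -
  have "(\<lambda>z. u z * f (\<psi> z)) holomorphic_on \<D>"
    using assms \<psi>_self holomorphic_on_compose_gen[OF \<psi>_hol, of f \<D>]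
    by (intro holomorphic_on_mult u_hol) (auto simp: analytic_disk_def o_def)
  then have "T f holomorphic_on \<D>"
    by (rule holomorphic_transform) (simp add: weighted_composition_def)
  then show ?thesis by (simp add: analytic_disk_def weighted_composition_def)
qed

lemma deriv_T:
  assumes "f \<in> analytic_disk" "norm z < 1"
  shows "deriv (T f) z = deriv u z * f (\<psi> z) + u z * deriv \<psi> z * deriv f (\<psi> z)"
proof -
  have D: "\<psi> z \<in> \<D>" "z \<in> \<D>" using assms norm_\<psi> by auto
  have f: "f holomorphic_on \<D>" using assms by (simp add: analytic_disk_def)
  have "(u has_field_derivative deriv u z) (at z)" "(\<psi> has_field_derivative deriv \<psi> z) (at z)"
    "(f has_field_derivative deriv f (\<psi> z)) (at (\<psi> z))"
    using holomorphic_derivI[OF u_hol open_ball D(2)] holomorphic_derivI[OF \<psi>_hol open_ball D(2)]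
      holomorphic_derivI[OF f open_ball D(1)] by auto
  then have d: "((\<lambda>z. u z * f (\<psi> z)) has_field_derivative
      deriv u z * f (\<psi> z) + deriv f (\<psi> z) * deriv \<psi> z * u z) (at z)"
    by (intro DERIV_mult DERIV_chain2[of f])
  have "(T f has_field_derivative deriv u z * f (\<psi> z) + deriv f (\<psi> z) * deriv \<psi> z * u z) (at z)"
    by (rule has_field_derivative_transform_within_open[OF d open_ball D(2)])
      (simp add: weighted_composition_def)
  then show ?thesis by (simp add: DERIV_imp_deriv mult_ac)
qed

lemma T_linear:
  "T (\<lambda>z. a * f z + b * g z) = (\<lambda>z. a * T f z + b * T g z)"
  by (auto simp: weighted_composition_def algebra_simps)

text \<open>The chain rule, with the growth bounds for \<open>f\<close> and \<open>f'\<close> at \<open>\<psi>(z)\<close>.\<close>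

lemma deriv_T_growth_class:
  obtains K where "0 < K"
    and "\<And>f M z. f \<in> growth_class p \<phi> M \<Longrightarrow> norm z < 1 \<Longrightarrow>
           (1 - (norm z)\<^sup>2) * norm (deriv (T f) z) \<le> M * (value_factor z + K * slope_factor z)"
proof -
  obtain K where K: "0 < K" "\<And>f M z. f \<in> growth_class p \<phi> M \<Longrightarrow> norm z < 1 \<Longrightarrow>
           norm (deriv f z) \<le> K * M * growth p \<phi> (norm z) / (1 - (norm z)\<^sup>2)"
    using growth_class_deriv_bound by metis
  show thesis
  proof (rule that[OF K(1)])
    fix f :: "complex \<Rightarrow> complex" and M :: real and z :: complex
    assume f: "f \<in> growth_class p \<phi> M" and z: "norm z < 1"
    define w where "w = 1 - (norm z)\<^sup>2"
    have w: "0 \<le> w" using z by (simp add: w_def power_le_one)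
    have f0: "norm (f (\<psi> z)) \<le> M * growth p \<phi> (norm (\<psi> z))"
      using f norm_\<psi>[OF z] by (simp add: growth_class_def)
    have "norm (deriv (T f) z) \<le> norm (deriv u z) * norm (f (\<psi> z)) +
        norm (u z * deriv \<psi> z) * norm (deriv f (\<psi> z))"
      using f z by (simp add: deriv_T growth_class_def norm_triangle_le norm_mult)
    also have "\<dots> \<le> norm (deriv u z) * (M * growth p \<phi> (norm (\<psi> z))) +
        norm (u z * deriv \<psi> z) * (K * M * growth p \<phi> (norm (\<psi> z)) / (1 - (norm (\<psi> z))\<^sup>2))"
      by (intro add_mono mult_left_mono f0 K(2)[OF f norm_\<psi>[OF z]]) auto
    finally have "w * norm (deriv (T f) z) \<le> w * \<dots>" using w by (rule mult_left_mono)
    also have "\<dots> = M * (value_factor z + K * slope_factor z)"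
      unfolding value_factor_def slope_factor_def w_def[symmetric] by (simp add: algebra_simps)
    finally show "(1 - (norm z)\<^sup>2) * norm (deriv (T f) z) \<le> M * (value_factor z + K * slope_factor z)"
      by (simp add: w_def)
  qed
qed

lemma T_growth_class_little_bloch:
  assumes U: "(value_factor \<longlongrightarrow> 0) to_circle" and V: "(slope_factor \<longlongrightarrow> 0) to_circle" and f: "f \<in> growth_class p \<phi> M"
  shows "T f \<in> little_bloch_space"
proof (rule little_bloch_spaceI)
  show "T f \<in> analytic_disk" using f by (intro T_analytic) (simp add: growth_class_def)
  obtain K where K: "\<And>f M z. f \<in> growth_class p \<phi> M \<Longrightarrow> norm z < 1 \<Longrightarrow>
           (1 - (norm z)\<^sup>2) * norm (deriv (T f) z) \<le> M * (value_factor z + K * slope_factor z)"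
    using deriv_T_growth_class by metis
  have "((\<lambda>z. M * (value_factor z + K * slope_factor z)) \<longlongrightarrow> M * (0 + K * 0)) to_circle"
    by (intro tendsto_intros U V)
  then have "((\<lambda>z. M * (value_factor z + K * slope_factor z)) \<longlongrightarrow> 0) to_circle" by simp
  then show "((\<lambda>z. (1 - (norm z)\<^sup>2) * norm (deriv (T f) z)) \<longlongrightarrow> 0) to_circle"
  proof (rule tendsto_sandwich[OF _ _ tendsto_const, rotated 2])
    show "eventually (\<lambda>z. 0 \<le> (1 - (norm z)\<^sup>2) * norm (deriv (T f) z)) to_circle"
      unfolding eventually_to_circle by (intro exI[of _ 0]) (auto simp: power_le_one)
    show "eventually (\<lambda>z. (1 - (norm z)\<^sup>2) * norm (deriv (T f) z) \<le> M * (value_factor z + K * slope_factor z)) to_circle"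
      unfolding eventually_to_circle using K[OF f] by (intro exI[of _ 0]) auto
  qed
qed

text \<open>Near the circle the two vanishing factors control the whole growth class at once. On the
remaining compact disk, \<open>\<psi>\<close> takes values in a compact subset of the unit disk, on which the
sequence and its derivatives are uniformly small.\<close>

lemma bloch_norm_T_null_sequence:
  assumes U: "(value_factor \<longlongrightarrow> 0) to_circle" and V: "(slope_factor \<longlongrightarrow> 0) to_circle"
    and h: "\<And>n::nat. h n \<in> growth_class p \<phi> M"
    and lim: "\<And>R. R < 1 \<Longrightarrow> uniform_limit (cball 0 R) h (\<lambda>_. 0) sequentially"
    and \<epsilon>: "0 < \<epsilon>"
  shows "eventually (\<lambda>n. bloch_norm (T (h n)) < \<epsilon>) sequentially"
proof -
  have hol: "h n holomorphic_on \<D>" and ana: "h n \<in> analytic_disk" for n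
    using h[of n] by (auto simp: growth_class_def analytic_disk_def)
  obtain K where K: "0 < K" "\<And>f M z. f \<in> growth_class p \<phi> M \<Longrightarrow> norm z < 1 \<Longrightarrow>
           (1 - (norm z)\<^sup>2) * norm (deriv (T f) z) \<le> M * (value_factor z + K * slope_factor z)"
    using deriv_T_growth_class by metis
  have "((\<lambda>z. M * (value_factor z + K * slope_factor z)) \<longlongrightarrow> M * (0 + K * 0)) to_circle"
    by (intro tendsto_intros U V)
  then have "eventually (\<lambda>z. M * (value_factor z + K * slope_factor z) < \<epsilon> / 2) to_circle"
    using \<epsilon> by (intro order_tendstoD(2)) auto
  then obtain b where b: "0 \<le> b" "b < 1"
    "\<And>z. b < norm z \<Longrightarrow> norm z < 1 \<Longrightarrow> M * (value_factor z + K * slope_factor z) < \<epsilon> / 2"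
    unfolding eventually_to_circle by blast
  obtain B1 where B1: "0 < B1" "\<And>z. norm z \<le> b \<Longrightarrow> norm (deriv u z) \<le> B1"
    using holomorphic_bounded_cball[OF holomorphic_deriv[OF u_hol open_ball] b(2)] by metis
  have hol2: "(\<lambda>z. u z * deriv \<psi> z) holomorphic_on \<D>"
    by (intro holomorphic_on_mult u_hol holomorphic_deriv \<psi>_hol open_ball)
  obtain B2 where B2: "0 < B2" "\<And>z. norm z \<le> b \<Longrightarrow> norm (u z * deriv \<psi> z) \<le> B2"
    using holomorphic_bounded_cball[OF hol2 b(2)] by metis
  have "compact ((\<lambda>z. norm (\<psi> z)) ` cball 0 b)"
    using b(2)
    by (intro compact_continuous_image continuous_on_norm holomorphic_on_imp_continuous_on
        holomorphic_on_subset[OF \<psi>_hol]) auto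
  then obtain z0 where z0: "z0 \<in> cball 0 b" "\<And>z. z \<in> cball 0 b \<Longrightarrow> norm (\<psi> z) \<le> norm (\<psi> z0)"
    using compact_attains_sup[of "(\<lambda>z. norm (\<psi> z)) ` cball 0 b"] b(1) by auto
  define R where "R = norm (\<psi> z0)"
  have R: "0 \<le> R" "R < 1" "\<And>z. norm z \<le> b \<Longrightarrow> norm (\<psi> z) \<le> R"
    using z0 b norm_\<psi>[of z0] by (auto simp: R_def)
  \<comment> \<open>Collects the factors of the sup bound \<open>\<delta>\<close> on the compact part: from the value at \<open>0\<close>, from
    the values, and from the derivatives, whose Cauchy estimate costs the factor \<open>2 / (1 - R)\<close>.\<close>
  define B where "B = norm (u 0) + B1 + B2 * (2 / (1 - R))"
  have B: "0 < B" using B1 B2 R by (simp add: B_def add_nonneg_pos add_pos_pos)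
  define \<delta> where "\<delta> = \<epsilon> / (4 * B)"
  have \<delta>: "0 < \<delta>" "B * \<delta> = \<epsilon> / 4" using B \<epsilon> by (auto simp: \<delta>_def)
  have "eventually (\<lambda>n. \<forall>w\<in>cball 0 ((1 + R) / 2). dist (h n w) 0 < \<delta>) sequentially"
    using lim[of "(1 + R) / 2"] R \<delta>(1) by (intro uniform_limitD) auto
  then show ?thesis
  proof (rule eventually_mono)
    fix n assume "\<forall>w\<in>cball 0 ((1 + R) / 2). dist (h n w) 0 < \<delta>"
    then have small: "norm (h n w) \<le> \<delta>" if "norm w \<le> (1 + R) / 2" for w
      using that by (force simp: dist_norm)
    have near: "norm (h n (\<psi> z)) \<le> \<delta>" "norm (deriv (h n) (\<psi> z)) \<le> 2 * \<delta> / (1 - R)"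
      if z: "norm z \<le> b" for z
    proof -
      have R': "norm (\<psi> z) \<le> R" by (rule R(3)[OF z])
      then show "norm (h n (\<psi> z)) \<le> \<delta>" using R by (intro small) auto
      have "norm (deriv (h n) (\<psi> z)) \<le> 2 * \<delta> / (1 - norm (\<psi> z))"
        using R' R(2) by (intro norm_deriv_le_disk[OF hol] small) auto
      also have "\<dots> \<le> 2 * \<delta> / (1 - R)" using R' R(2) \<delta>(1) by (intro divide_left_mono) auto
      finally show "norm (deriv (h n) (\<psi> z)) \<le> 2 * \<delta> / (1 - R)" .
    qed
    have "bloch_norm (T (h n)) \<le> norm (T (h n) 0) + \<epsilon> / 2"
    proof (rule bloch_norm_le)
      fix z :: complex assume z: "norm z < 1"
      show "(1 - (norm z)\<^sup>2) * norm (deriv (T (h n)) z) \<le> \<epsilon> / 2"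
      proof (cases "b < norm z")
        case True
        then show ?thesis using K(2)[OF h[of n] z] b(3)[OF True z] by linarith
      next
        case False
        then have zb: "norm z \<le> b" by simp
        have "(1 - (norm z)\<^sup>2) * norm (deriv (T (h n)) z) \<le> 1 * norm (deriv (T (h n)) z)"
          by (intro mult_right_mono) auto
        also have "\<dots> \<le> norm (deriv u z) * norm (h n (\<psi> z)) +
            norm (u z * deriv \<psi> z) * norm (deriv (h n) (\<psi> z))"
          using z ana by (simp add: deriv_T norm_triangle_le norm_mult)
        also have "\<dots> \<le> B1 * \<delta> + B2 * (2 * \<delta> / (1 - R))"
          using B1 B2 zb by (intro add_mono mult_mono near) auto
        also have "\<dots> \<le> B * \<delta>" using \<delta>(1) by (simp add: B_def algebra_simps)
        also have "\<dots> \<le> \<epsilon> / 2" using \<delta>(2) \<epsilon> by simp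
        finally show ?thesis .
      qed
    qed
    also have "norm (T (h n) 0) \<le> norm (u 0) * \<delta>"
      using near(1)[of 0] b(1) by (simp add: weighted_composition_def norm_mult mult_left_mono)
    also have "norm (u 0) * \<delta> \<le> B * \<delta>"
      using B1 B2 R \<delta>(1) by (intro mult_right_mono) (auto simp: B_def)
    finally show "bloch_norm (T (h n)) < \<epsilon>" using \<delta>(2) \<epsilon> by simp
  qed
qed

lemma growth_class_bounded_cball:
  assumes f: "f \<in> growth_class p \<phi> M" and R: "norm z \<le> R" "R < 1"
  shows "norm (f z) \<le> M * growth p \<phi> R"
  using f R by (intro maximum_modulus_disk[of f R z]) (auto simp: growth_class_def analytic_disk_def)

text \<open>The limit is cut off outside the disk, so that it is an element of the function space.\<close>

lemma growth_class_Montel: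
  assumes f: "\<And>n::nat. f n \<in> growth_class p \<phi> M"
  obtains g r where "g \<in> growth_class p \<phi> M" "strict_mono (r :: nat \<Rightarrow> nat)"
    and "\<And>R. R < 1 \<Longrightarrow> uniform_limit (cball 0 R) (f \<circ> r) g sequentially"
proof -
  have bdd: "\<exists>B. \<forall>h \<in> growth_class p \<phi> M. \<forall>z \<in> K. norm (h z) \<le> B" if K: "compact K" "K \<subseteq> \<D>" for K
  proof (cases "K = {}")
    case False
    obtain x where x: "x \<in> K" "\<And>z. z \<in> K \<Longrightarrow> norm z \<le> norm x"
      using continuous_attains_sup[OF K(1) False, of norm] by (auto intro: continuous_intros)
    have "norm x < 1" using K(2) x(1) by auto
    then have "norm (h z) \<le> M * growth p \<phi> (norm x)"
      if "h \<in> growth_class p \<phi> M" "z \<in> K" for h z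
      using growth_class_bounded_cball[OF that(1) x(2)[OF that(2)]] by blast
    then show ?thesis by blast
  qed simp
  obtain g r where g: "g holomorphic_on \<D>" and r: "strict_mono (r :: nat \<Rightarrow> nat)"
    and pt: "\<And>x. x \<in> \<D> \<Longrightarrow> ((\<lambda>n. f (r n) x) \<longlongrightarrow> g x) sequentially"
    and unif: "\<And>K. compact K \<Longrightarrow> K \<subseteq> \<D> \<Longrightarrow> uniform_limit K (f \<circ> r) g sequentially"
  proof (rule Montel[of \<D> "growth_class p \<phi> M" f])
    show "h holomorphic_on \<D>" if "h \<in> growth_class p \<phi> M" for h
      using that by (simp add: growth_class_def analytic_disk_def)
  qed (use f bdd in auto)
  define g' where "g' = (\<lambda>z. if z \<in> \<D> then g z else 0)"
  have eq: "g z = g' z" if "z \<in> \<D>" for z using that by (simp add: g'_def)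
  show thesis
  proof (rule that[OF _ r])
    have "norm (g' z) \<le> M * growth p \<phi> (norm z)" if z: "z \<in> \<D>" for z
    proof -
      have "((\<lambda>n. norm (f (r n) z)) \<longlongrightarrow> norm (g' z)) sequentially"
        using pt[OF z] by (intro tendsto_norm) (simp add: eq[OF z])
      then show ?thesis
        using f z by (intro Lim_bounded[of _ _ 0]) (auto simp: growth_class_def)
    qed
    moreover have "g' holomorphic_on \<D>" by (rule holomorphic_transform[OF g eq])
    ultimately show "g' \<in> growth_class p \<phi> M"
      by (simp add: growth_class_def analytic_disk_def g'_def)
    fix R :: real assume "R < 1"
    then have "cball 0 R \<subseteq> \<D>" by auto
    then show "uniform_limit (cball 0 R) (f \<circ> r) g' sequentially"
      using unif[of "cball 0 R"] by (subst uniform_limit_cong'[of _ _ "f \<circ> r" g' g]) (auto simp: g'_def)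
  qed
qed

lemma compactin_T_growth_class:
  assumes U: "(value_factor \<longlongrightarrow> 0) to_circle" and V: "(slope_factor \<longlongrightarrow> 0) to_circle"
  shows "compactin (Metric_space.mtopology little_bloch_space (norm_dist bloch_norm))
           (T ` growth_class p \<phi> M)"
  unfolding Metric_space.compactin_sequentially[OF Metric_space_little_bloch]
proof (intro conjI allI impI)
  show sub: "T ` growth_class p \<phi> M \<subseteq> little_bloch_space"
    using T_growth_class_little_bloch[OF U V] by auto
  fix \<sigma> :: "nat \<Rightarrow> complex \<Rightarrow> complex" assume "range \<sigma> \<subseteq> T ` growth_class p \<phi> M"
  then have "\<forall>n. \<exists>f. f \<in> growth_class p \<phi> M \<and> \<sigma> n = T f" by (auto simp: image_subset_iff image_iff)
  then obtain f where f: "\<And>n. f n \<in> growth_class p \<phi> M" "\<And>n. \<sigma> n = T (f n)" by metis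
  obtain g r where g: "g \<in> growth_class p \<phi> M" and r: "strict_mono (r :: nat \<Rightarrow> nat)"
    and unif: "\<And>R. R < 1 \<Longrightarrow> uniform_limit (cball 0 R) (f \<circ> r) g sequentially"
    using growth_class_Montel[of f M] f(1) by metis
  define h where "h = (\<lambda>n z. f (r n) z - g z)"
  have h: "h n \<in> growth_class p \<phi> (2 * M)" for n
  proof -
    have "norm (h n z) \<le> 2 * M * growth p \<phi> (norm z)" if "z \<in> \<D>" for z
    proof -
      have "norm (f (r n) z) \<le> M * growth p \<phi> (norm z)" "norm (g z) \<le> M * growth p \<phi> (norm z)"
        using f(1)[of "r n"] g that by (auto simp: growth_class_def)
      then show ?thesis using norm_triangle_ineq4[of "f (r n) z" "g z"] by (simp add: h_def)
    qed
    then show ?thesis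
      using f(1)[of "r n"] g
      by (auto simp: growth_class_def analytic_disk_def h_def intro!: holomorphic_on_diff)
  qed
  have hlim: "uniform_limit (cball 0 R) h (\<lambda>_. 0) sequentially" if "R < 1" for R
    using unif[OF that] by (simp add: uniform_limit_iff h_def dist_norm)
  have dist: "norm_dist bloch_norm (\<sigma> (r n)) (T g) = bloch_norm (T (h n))" for n
  proof -
    have "(\<lambda>z. \<sigma> (r n) z - T g z) = T (h n)"
      by (auto simp: f(2) h_def weighted_composition_def algebra_simps)
    then show ?thesis by (simp add: norm_dist_def)
  qed
  have "limitin (Metric_space.mtopology little_bloch_space (norm_dist bloch_norm)) (\<sigma> \<circ> r) (T g) sequentially"
    unfolding Metric_space.limitin_metric[OF Metric_space_little_bloch]
  proof (intro conjI allI impI)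
    show "T g \<in> little_bloch_space" using sub g by auto
    fix \<epsilon> :: real assume \<epsilon>: "0 < \<epsilon>"
    have "\<sigma> (r n) \<in> little_bloch_space" for n using sub f by auto
    then show "eventually (\<lambda>n. (\<sigma> \<circ> r) n \<in> little_bloch_space \<and>
        norm_dist bloch_norm ((\<sigma> \<circ> r) n) (T g) < \<epsilon>) sequentially"
      using bloch_norm_T_null_sequence[OF U V h hlim \<epsilon>] by (simp add: dist)
  qed
  then show "\<exists>l r. l \<in> T ` growth_class p \<phi> M \<and> strict_mono r \<and>
      limitin (Metric_space.mtopology little_bloch_space (norm_dist bloch_norm)) (\<sigma> \<circ> r) l sequentially"
    using g r by blast
qed

lemma compact_operator_if_vanishing:
  assumes U: "(value_factor \<longlongrightarrow> 0) to_circle" and V: "(slope_factor \<longlongrightarrow> 0) to_circle"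
  shows "compact_operator (mixed_space p \<phi>) (mixed_norm p \<phi>) little_bloch_space bloch_norm T"
proof -
  define \<tau> where "\<tau> = Metric_space.mtopology little_bloch_space (norm_dist bloch_norm)"
  obtain K where "0 < K" and K: "\<And>f M. f \<in> mixed_space p \<phi> \<Longrightarrow> mixed_norm p \<phi> f \<le> M \<Longrightarrow>
      f \<in> growth_class p \<phi> (K * M)"
    using mixed_norm_bounded_imp_growth_class by blast
  have "T ` mixed_space p \<phi> \<subseteq> little_bloch_space"
    using K[OF _ order_refl] T_growth_class_little_bloch[OF U V] by blast
  moreover have "compactin \<tau> (\<tau> closure_of (T ` S))"
    if S: "S \<subseteq> mixed_space p \<phi>" "\<And>f. f \<in> S \<Longrightarrow> mixed_norm p \<phi> f \<le> C" for S C
  proof -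
    have "T ` S \<subseteq> T ` growth_class p \<phi> (K * C)" using S K by blast
    moreover have c: "compactin \<tau> (T ` growth_class p \<phi> (K * C))"
      unfolding \<tau>_def by (rule compactin_T_growth_class[OF U V])
    moreover have "Hausdorff_space \<tau>"
      unfolding \<tau>_def by (rule Metric_space.Hausdorff_space_mtopology[OF Metric_space_little_bloch])
    ultimately have "\<tau> closure_of (T ` S) \<subseteq> T ` growth_class p \<phi> (K * C)"
      by (intro closure_of_minimal compactin_imp_closedin)
    then show ?thesis by (rule closed_compactin[OF c _ closedin_closure_of])
  qed
  ultimately show ?thesis
    unfolding compact_operator_def \<tau>_def[symmetric] Let_def by (simp add: T_linear) meson
qed

end

section \<open>Necessity: test functions\<close>

text \<open>A finite \<open>\<epsilon>/2\<close>-net of the closure consists of functions in the little Bloch space. Near the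
circle all of these are small simultaneously, and every other element is close to one of
them.\<close>

lemma compact_closure_imp_uniform_little_bloch:
  assumes Q: "Q \<subseteq> little_bloch_space"
    and cpt: "compactin (Metric_space.mtopology little_bloch_space (norm_dist bloch_norm))
        (Metric_space.mtopology little_bloch_space (norm_dist bloch_norm) closure_of Q)"
    and \<epsilon>: "0 < \<epsilon>"
  shows "eventually (\<lambda>z. \<forall>h\<in>Q. (1 - (norm z)\<^sup>2) * norm (deriv h z) < \<epsilon>) to_circle"
proof -
  interpret Metric_space little_bloch_space "norm_dist bloch_norm"
    by (rule Metric_space_little_bloch)
  define W where "W = mtopology closure_of Q"
  have QW: "Q \<subseteq> W" unfolding W_def using Q by (intro closure_of_subset) simp
  have "mtotally_bounded W"
    using cpt unfolding W_def by (rule compactin_imp_mtotally_bounded)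
  then obtain F where F: "finite F" "F \<subseteq> W" "W \<subseteq> (\<Union>x\<in>F. mball x (\<epsilon> / 2))"
    using \<epsilon> unfolding mtotally_bounded_def by (meson half_gt_zero)
  have WL: "W \<subseteq> little_bloch_space"
    unfolding W_def using closure_of_subset_topspace[of mtopology Q] by simp
  have "eventually (\<lambda>z. \<forall>g\<in>F. (1 - (norm z)\<^sup>2) * norm (deriv g z) < \<epsilon> / 2) to_circle"
  proof (rule eventually_ball_finite[OF F(1)], rule ballI)
    fix g assume "g \<in> F"
    then have "((\<lambda>z. (1 - (norm z)\<^sup>2) * norm (deriv g z)) \<longlongrightarrow> 0) to_circle"
      using F(2) WL by (auto simp: little_bloch_space_def)
    then show "eventually (\<lambda>z. (1 - (norm z)\<^sup>2) * norm (deriv g z) < \<epsilon> / 2) to_circle"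
      using \<epsilon> by (intro order_tendstoD(2)) auto
  qed
  moreover have "eventually (\<lambda>z. norm z < 1) to_circle"
    unfolding eventually_to_circle by (intro exI[of _ 0]) auto
  ultimately show ?thesis
  proof eventually_elim
    fix z assume g: "\<forall>g\<in>F. (1 - (norm z)\<^sup>2) * norm (deriv g z) < \<epsilon> / 2" and z: "norm z < 1"
    show "\<forall>h\<in>Q. (1 - (norm z)\<^sup>2) * norm (deriv h z) < \<epsilon>"
    proof
      fix h assume h: "h \<in> Q"
      then obtain g where gF: "g \<in> F" and gh: "h \<in> mball g (\<epsilon> / 2)" using QW F(3) by blast
      have B: "g \<in> bloch_space" "h \<in> bloch_space"
        using gh unfolding in_mball by (auto simp: little_bloch_space_def)
      have "(1 - (norm z)\<^sup>2) * norm (deriv (\<lambda>z. g z - h z) z) \<le> enn2real (bloch_seminorm (\<lambda>z. g z - h z))"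
        by (rule deriv_le_bloch_seminorm[OF bloch_seminorm_diff_finite[OF B] z])
      also have "\<dots> \<le> norm_dist bloch_norm g h" by (simp add: norm_dist_def bloch_norm_def)
      also have "\<dots> < \<epsilon> / 2" using gh by simp
      finally have *: "(1 - (norm z)\<^sup>2) * norm (deriv g z - deriv h z) < \<epsilon> / 2"
        using B z by (simp add: deriv_diff_disk bloch_space_def)
      have "norm (deriv h z) \<le> norm (deriv g z) + norm (deriv g z - deriv h z)"
        using norm_triangle_ineq4[of "deriv g z" "deriv g z - deriv h z"] by simp
      then have "(1 - (norm z)\<^sup>2) * norm (deriv h z) \<le>
          (1 - (norm z)\<^sup>2) * (norm (deriv g z) + norm (deriv g z - deriv h z))"
        using z by (intro mult_left_mono) (auto simp: power_le_one)
      also have "\<dots> < \<epsilon>" using * g gF by (auto simp: distrib_left) 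
      finally show "(1 - (norm z)\<^sup>2) * norm (deriv h z) < \<epsilon>" .
    qed
  qed
qed

text \<open>Elements of the spaces are functions that vanish outside the disk.\<close>

definition disk_part :: "(complex \<Rightarrow> complex) \<Rightarrow> complex \<Rightarrow> complex" where
  "disk_part f = (\<lambda>z. if z \<in> \<D> then f z else 0)"

lemma disk_part_analytic:
  assumes "f holomorphic_on \<D>"
  shows "disk_part f \<in> analytic_disk" "disk_part f holomorphic_on \<D>"
proof -
  show "disk_part f holomorphic_on \<D>"
    by (rule holomorphic_transform[OF assms]) (simp add: disk_part_def)
  then show "disk_part f \<in> analytic_disk"
    by (simp add: analytic_disk_def disk_part_def)
qed

lemma deriv_disk_part:
  assumes "(f has_field_derivative f') (at a)" "norm a < 1"
  shows "deriv (disk_part f) a = f'"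
proof (rule DERIV_imp_deriv)
  show "(disk_part f has_field_derivative f') (at a)"
    by (rule has_field_derivative_transform_within_open[OF assms(1) open_ball[of 0 1]])
      (use assms(2) in \<open>auto simp: disk_part_def\<close>)
qed

text \<open>The Szego kernel at \<open>a\<close>, normalised to take the value \<open>1\<close> at \<open>a\<close>.\<close>

definition disk_kernel :: "complex \<Rightarrow> complex \<Rightarrow> complex" where
  "disk_kernel a z = of_real (1 - (norm a)\<^sup>2) / (1 - cnj a * z)"

text \<open>The disk automorphism that sends \<open>a\<close> to the origin. It vanishes at \<open>a\<close> with a slope of the
largest possible order, also for \<open>a\<close> near \<open>0\<close>, where the slope of the kernel degenerates.\<close>

definition disk_shift :: "complex \<Rightarrow> complex \<Rightarrow> complex" where
  "disk_shift a z = (z - a) / (1 - cnj a * z)"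

lemma norm_disk_shift_le_1:
  assumes "norm a < 1" "norm z < 1"
  shows "norm (disk_shift a z) \<le> 1"
  using Moebius_function_norm_lt_1[OF assms, of 0]
  by (simp add: disk_shift_def Moebius_function_simple)

lemma disk_kernel_holomorphic: "norm a < 1 \<Longrightarrow> disk_kernel a holomorphic_on \<D>"
  unfolding disk_kernel_def using one_minus_cnj_mult_nonzero by (intro holomorphic_intros) auto

lemma disk_shift_holomorphic: "norm a < 1 \<Longrightarrow> disk_shift a holomorphic_on \<D>"
  unfolding disk_shift_def using one_minus_cnj_mult_nonzero by (intro holomorphic_intros) auto

lemma
  assumes "norm a < 1"
  shows disk_kernel_at: "disk_kernel a a = 1"
    and disk_kernel_deriv:
      "(disk_kernel a has_field_derivative cnj a / of_real (1 - (norm a)\<^sup>2)) (at a)"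
    and disk_shift_at: "disk_shift a a = 0"
    and disk_shift_deriv:
      "(disk_shift a has_field_derivative 1 / of_real (1 - (norm a)\<^sup>2)) (at a)"
proof -
  have eq: "1 - cnj a * a = of_real (1 - (norm a)\<^sup>2)"
    using complex_norm_square[of a] by (simp add: mult.commute)
  have nz: "of_real (1 - (norm a)\<^sup>2) \<noteq> (0::complex)"
    using one_minus_cnj_mult_nonzero[OF assms assms] unfolding eq .
  show "disk_kernel a a = 1" unfolding disk_kernel_def eq using nz by simp
  show "disk_shift a a = 0" by (simp add: disk_shift_def)
  define c where "c = complex_of_real (1 - (norm a)\<^sup>2)"
  have c: "c \<noteq> 0" "1 - cnj a * a = c" using nz eq by (auto simp: c_def)
  show "(disk_kernel a has_field_derivative cnj a / of_real (1 - (norm a)\<^sup>2)) (at a)"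
    unfolding disk_kernel_def[abs_def] c_def[symmetric]
    by (rule derivative_eq_intros refl | use c in force)+
  show "(disk_shift a has_field_derivative 1 / of_real (1 - (norm a)\<^sup>2)) (at a)"
    unfolding disk_shift_def[abs_def] c_def[symmetric]
    by (rule derivative_eq_intros refl | use c in force)+
qed

context mixed_weight
begin

text \<open>The last factor cancels the logarithmic derivative of the kernel power at \<open>a\<close>, so that only
the term with \<open>u'\<close> survives in the derivative of the image at a point that \<open>\<psi>\<close> sends to \<open>a\<close>.\<close>

definition value_test :: "nat \<Rightarrow> complex \<Rightarrow> complex \<Rightarrow> complex" where
  "value_test N a = disk_part (\<lambda>z. of_real (growth p \<phi> (norm a)) *
      (disk_kernel a z ^ N * (1 - of_nat N * cnj a * disk_shift a z)))"

text \<open>The zero at \<open>a\<close> removes the term with \<open>u'\<close> instead.\<close>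

definition slope_test :: "nat \<Rightarrow> complex \<Rightarrow> complex \<Rightarrow> complex" where
  "slope_test N a = disk_part (\<lambda>z. of_real (growth p \<phi> (norm a)) *
      (disk_kernel a z ^ N * disk_shift a z))"

lemma test_functions_analytic:
  assumes "norm a < 1"
  shows "value_test N a \<in> analytic_disk" "slope_test N a \<in> analytic_disk"
  unfolding value_test_def slope_test_def using assms
  by (intro disk_part_analytic holomorphic_intros disk_kernel_holomorphic disk_shift_holomorphic; simp)+

lemma value_test_at:
  assumes "norm a < 1"
  shows "value_test N a a = of_real (growth p \<phi> (norm a))" "deriv (value_test N a) a = 0"
proof -
  show "value_test N a a = of_real (growth p \<phi> (norm a))"
    using assms by (simp add: value_test_def disk_part_def disk_kernel_at disk_shift_at)
  define c where "c = complex_of_real (1 - (norm a)\<^sup>2)"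
  show "deriv (value_test N a) a = 0"
    unfolding value_test_def
    by (rule deriv_disk_part[OF _ assms])
      (auto intro!: derivative_eq_intros disk_kernel_deriv disk_shift_deriv assms
        simp: disk_kernel_at disk_shift_at assms simp flip: c_def)
qed

lemma slope_test_at:
  assumes "norm a < 1"
  shows "slope_test N a a = 0"
    "deriv (slope_test N a) a = of_real (growth p \<phi> (norm a) / (1 - (norm a)\<^sup>2))"
proof -
  show "slope_test N a a = 0"
    using assms by (simp add: slope_test_def disk_part_def disk_shift_at)
  show "deriv (slope_test N a) a = of_real (growth p \<phi> (norm a) / (1 - (norm a)\<^sup>2))"
    unfolding slope_test_def
    by (rule deriv_disk_part[OF _ assms])
      (auto intro!: derivative_eq_intros disk_kernel_deriv disk_shift_deriv assms
        simp: disk_kernel_at disk_shift_at assms)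
qed

lemma test_functions_bounded:
  obtains N C where
    "\<And>a. norm a < 1 \<Longrightarrow> value_test N a \<in> mixed_space p \<phi> \<and> mixed_norm p \<phi> (value_test N a) \<le> C"
    "\<And>a. norm a < 1 \<Longrightarrow> slope_test N a \<in> mixed_space p \<phi> \<and> mixed_norm p \<phi> (slope_test N a) \<le> C"
proof -
  obtain N :: nat and D where D: "0 < D" "\<And>f a K. f holomorphic_on \<D> \<Longrightarrow> norm a < 1 \<Longrightarrow> 0 \<le> K \<Longrightarrow>
        (\<And>z. norm z < 1 \<Longrightarrow> norm (f z) \<le> K * ((1 - (norm a)\<^sup>2) / norm (1 - cnj a * z)) ^ N) \<Longrightarrow>
        mixed_integral p \<phi> f \<le> ennreal (D * (K / growth p \<phi> (norm a)) powr p)"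
    using mixed_integral_upper_bound by metis
  define C where "C = (D * (1 + real N) powr p) powr (1 / p)"
  have crit: "f \<in> mixed_space p \<phi> \<and> mixed_norm p \<phi> f \<le> C"
    if f: "f \<in> analytic_disk" and a: "norm a < 1"
      and le: "\<And>z. norm z < 1 \<Longrightarrow>
        norm (f z) \<le> (1 + real N) * growth p \<phi> (norm a) * norm (disk_kernel a z) ^ N" for f a
  proof -
    have g: "0 < growth p \<phi> (norm a)" using a growth_pos by simp
    have q: "0 \<le> 1 - (norm a)\<^sup>2" using a by (simp add: power_le_one)
    have nk: "norm (disk_kernel a z) = (1 - (norm a)\<^sup>2) / norm (1 - cnj a * z)" for z
      using q by (simp add: disk_kernel_def norm_divide del: of_real_diff)
    have "mixed_integral p \<phi> f \<le>
        ennreal (D * ((1 + real N) * growth p \<phi> (norm a) / growth p \<phi> (norm a)) powr p)"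
    proof (rule D(2))
      show "f holomorphic_on \<D>" using f by (simp add: analytic_disk_def)
    qed (use a g le in \<open>auto simp: nk\<close>)
    then have I: "mixed_integral p \<phi> f \<le> ennreal (D * (1 + real N) powr p)" using g by simp
    then have "mixed_integral p \<phi> f < \<infinity>" using le_less_trans by fastforce
    moreover have "mixed_norm p \<phi> f \<le> C"
      unfolding mixed_norm_def C_def using p_pos D(1)
      by (intro powr_mono2 enn2real_leI I) auto
    ultimately show ?thesis using f by (simp add: mixed_space_def)
  qed
  show thesis
  proof (rule that[of N C])
    fix a :: complex assume a: "norm a < 1"
    have g: "0 < growth p \<phi> (norm a)" using a growth_pos by simp
    show "value_test N a \<in> mixed_space p \<phi> \<and> mixed_norm p \<phi> (value_test N a) \<le> C"
    proof (rule crit[OF test_functions_analytic(1)[OF a] a])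
      fix z :: complex assume z: "norm z < 1"
      have "norm (1 - of_nat N * cnj a * disk_shift a z) \<le>
          norm (1::complex) + norm (of_nat N * cnj a * disk_shift a z)"
        by (rule norm_triangle_ineq4)
      also have "\<dots> \<le> 1 + real N"
        using mult_le_one[of "norm a" "norm (disk_shift a z)"] a norm_disk_shift_le_1[OF a z]
        by (simp add: norm_mult mult.assoc mult_left_le)
      finally have "norm (1 - of_nat N * cnj a * disk_shift a z) \<le> 1 + real N" by simp
      then have "growth p \<phi> (norm a) * (norm (disk_kernel a z) ^ N * norm (1 - of_nat N * cnj a * disk_shift a z))
          \<le> growth p \<phi> (norm a) * (norm (disk_kernel a z) ^ N * (1 + real N))"
        using g by (intro mult_left_mono) auto
      then show "norm (value_test N a z) \<le>
          (1 + real N) * growth p \<phi> (norm a) * norm (disk_kernel a z) ^ N"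
        using z g by (simp add: value_test_def disk_part_def norm_mult norm_power mult_ac)
    qed
    show "slope_test N a \<in> mixed_space p \<phi> \<and> mixed_norm p \<phi> (slope_test N a) \<le> C"
    proof (rule crit[OF test_functions_analytic(2)[OF a] a])
      fix z :: complex assume z: "norm z < 1"
      have "growth p \<phi> (norm a) * (norm (disk_kernel a z) ^ N * norm (disk_shift a z))
          \<le> growth p \<phi> (norm a) * (norm (disk_kernel a z) ^ N * (1 + real N))"
        using g norm_disk_shift_le_1[OF a z] by (intro mult_left_mono) auto
      then show "norm (slope_test N a z) \<le>
          (1 + real N) * growth p \<phi> (norm a) * norm (disk_kernel a z) ^ N"
        using z g by (simp add: slope_test_def disk_part_def norm_mult norm_power mult_ac)
    qed
  qed
qed

end

context mixed_weight_composition
begin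

text \<open>All test functions lie in one ball of \<open>H(p,p,\<phi>)\<close>, so their images are uniformly small at the
circle in the sense of \<open>compact_closure_imp_uniform_little_bloch\<close>. This uniformity allows
the test function to depend on the point \<open>z\<close> at which its image is evaluated.\<close>

lemma vanishing_if_compact_operator:
  assumes "compact_operator (mixed_space p \<phi>) (mixed_norm p \<phi>) little_bloch_space bloch_norm T"
  shows "(value_factor \<longlongrightarrow> 0) to_circle" "(slope_factor \<longlongrightarrow> 0) to_circle"
proof -
  obtain N C where
    test1: "\<And>a. norm a < 1 \<Longrightarrow> value_test N a \<in> mixed_space p \<phi> \<and> mixed_norm p \<phi> (value_test N a) \<le> C"
    and test2: "\<And>a. norm a < 1 \<Longrightarrow> slope_test N a \<in> mixed_space p \<phi> \<and> mixed_norm p \<phi> (slope_test N a) \<le> C"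
    using test_functions_bounded by metis
  define S where "S = {f \<in> mixed_space p \<phi>. mixed_norm p \<phi> f \<le> C}"
  have sub: "T ` S \<subseteq> little_bloch_space"
    using assms by (auto simp: compact_operator_def S_def)
  have "S \<subseteq> mixed_space p \<phi>" "\<exists>C. \<forall>f\<in>S. mixed_norm p \<phi> f \<le> C" by (auto simp: S_def)
  then have cpt: "compactin (Metric_space.mtopology little_bloch_space (norm_dist bloch_norm))
        (Metric_space.mtopology little_bloch_space (norm_dist bloch_norm) closure_of (T ` S))"
    using assms unfolding compact_operator_def Let_def by blast
  have ev: "eventually (\<lambda>z. value_factor z < \<epsilon> \<and> slope_factor z < \<epsilon> \<and> norm z < 1) to_circle" if "0 < \<epsilon>" for \<epsilon>
  proof -
    have "eventually (\<lambda>z. \<forall>h\<in>T ` S. (1 - (norm z)\<^sup>2) * norm (deriv h z) < \<epsilon>) to_circle"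
      by (rule compact_closure_imp_uniform_little_bloch[OF sub cpt that])
    moreover have "eventually (\<lambda>z. norm z < 1) to_circle"
      unfolding eventually_to_circle by (intro exI[of _ 0]) auto
    ultimately show ?thesis
    proof eventually_elim
      fix z assume small: "\<forall>h\<in>T ` S. (1 - (norm z)\<^sup>2) * norm (deriv h z) < \<epsilon>" and z: "norm z < 1"
      define a where "a = \<psi> z"
      have a: "norm a < 1" using norm_\<psi>[OF z] by (simp add: a_def)
      have g: "0 < growth p \<phi> (norm a)" using a growth_pos by simp
      have q: "0 < 1 - (norm a)\<^sup>2" using a by (simp add: abs_square_less_1)
      have "deriv (T (value_test N a)) z = deriv u z * of_real (growth p \<phi> (norm a))"
        using deriv_T[OF test_functions_analytic(1)[OF a] z, folded a_def] a
        by (simp add: value_test_at)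
      moreover have "value_test N a \<in> S" using test1[OF a] by (simp add: S_def)
      ultimately have "value_factor z < \<epsilon>"
        using small g by (force simp: value_factor_def norm_mult a_def mult.assoc)
      have "deriv (T (slope_test N a)) z =
          u z * deriv \<psi> z * of_real (growth p \<phi> (norm a) / (1 - (norm a)\<^sup>2))"
        using deriv_T[OF test_functions_analytic(2)[OF a] z, folded a_def] a
        by (simp add: slope_test_at)
      then have "norm (deriv (T (slope_test N a)) z) =
          norm (u z * deriv \<psi> z) * (growth p \<phi> (norm a) / (1 - (norm a)\<^sup>2))"
        using g q by (simp only: norm_mult norm_of_real) simp
      moreover have "slope_test N a \<in> S" using test2[OF a] by (simp add: S_def)
      ultimately have "slope_factor z < \<epsilon>"
        using small by (force simp: slope_factor_def a_def mult.assoc)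
      with \<open>value_factor z < \<epsilon>\<close> z show "value_factor z < \<epsilon> \<and> slope_factor z < \<epsilon> \<and> norm z < 1" by simp
    qed
  qed
  show "(value_factor \<longlongrightarrow> 0) to_circle"
    unfolding tendsto_iff
  proof (intro allI impI)
    fix \<epsilon> :: real assume "0 < \<epsilon>"
    from ev[OF this] show "eventually (\<lambda>z. dist (value_factor z) 0 < \<epsilon>) to_circle"
      by (rule eventually_mono) (auto dest: value_factor_nonneg)
  qed
  show "(slope_factor \<longlongrightarrow> 0) to_circle"
    unfolding tendsto_iff
  proof (intro allI impI)
    fix \<epsilon> :: real assume "0 < \<epsilon>"
    from ev[OF this] show "eventually (\<lambda>z. dist (slope_factor z) 0 < \<epsilon>) to_circle"
      by (rule eventually_mono) (auto dest: slope_factor_nonneg)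
  qed
qed

lemma value_factor_eq: "value_factor z = (1 - (norm z)\<^sup>2) * norm (deriv u z) /
    (\<phi> (norm (\<psi> z)) * (1 - (norm (\<psi> z))\<^sup>2) powr (1 / p))"
  by (simp add: value_factor_def growth_def)

lemma slope_factor_eq:
  assumes "norm z < 1"
  shows "slope_factor z = (1 - (norm z)\<^sup>2) * norm (u z * deriv \<psi> z) /
    (\<phi> (norm (\<psi> z)) * (1 - (norm (\<psi> z))\<^sup>2) powr (1 + 1 / p))"
proof -
  have "0 < 1 - (norm (\<psi> z))\<^sup>2" using norm_\<psi>[OF assms] by (simp add: abs_square_less_1)
  then show ?thesis by (simp add: slope_factor_def growth_def powr_add mult_ac)
qed

end

theorem theorem4p5:
  fixes \<psi> u :: "complex \<Rightarrow> complex" and p :: real and \<phi> :: "real \<Rightarrow> real"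
  assumes "\<psi> holomorphic_on \<D>" and "\<psi> ` \<D> \<subseteq> \<D>"
    and "u holomorphic_on \<D>"
    and "0 < p"
    and "normal_weight \<phi>"
  shows "compact_operator (mixed_space p \<phi>) (mixed_norm p \<phi>) little_bloch_space bloch_norm
           (weighted_composition u \<psi>) \<longleftrightarrow>
         ((\<lambda>z. (1 - (norm z)\<^sup>2) * norm (deriv u z) /
                (\<phi> (norm (\<psi> z)) * (1 - (norm (\<psi> z))\<^sup>2) powr (1 / p))) \<longlongrightarrow> 0) to_circle \<and>
         ((\<lambda>z. (1 - (norm z)\<^sup>2) * norm (u z * deriv \<psi> z) /
                (\<phi> (norm (\<psi> z)) * (1 - (norm (\<psi> z))\<^sup>2) powr (1 + 1 / p))) \<longlongrightarrow> 0) to_circle"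
proof -
  interpret mixed_weight_composition p \<phi> \<psi> u by unfold_locales (fact assms)+
  have "eventually (\<lambda>z. slope_factor z = (1 - (norm z)\<^sup>2) * norm (u z * deriv \<psi> z) /
      (\<phi> (norm (\<psi> z)) * (1 - (norm (\<psi> z))\<^sup>2) powr (1 + 1 / p))) to_circle"
    unfolding eventually_to_circle using slope_factor_eq by (intro exI[of _ 0]) auto
  from tendsto_cong[OF this] show ?thesis
    using compact_operator_if_vanishing vanishing_if_compact_operator
    unfolding value_factor_eq[symmetric] by blast
qed

end
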